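(* Let $(H,\pi)$ be a uni-balanced irreflexive signed graph whose unicoloured edges contain a connected spanning subgraph of $H$. If $(H,\pi)$ has a special bipartite min ordering, then $\textsc{List-S-Hom}(H,\pi)$ is polynomial-time solvable.
   Context: A signed graph is a graph with each edge unicoloured (blue $+$ / red $-$) or bicoloured (a red–blue pair of parallel edges); irreflexive means no loops. Switching at a vertex negates the signs of incident edges. It is uni-balanced if every cycle consisting of unicoloured edges has an even number of red edges (equivalently, after switching all unicoloured edges are blue). A homomorphism $(G,\sigma)\to(H,\pi)$ is a map $f\colon V(G)\to V(H)$ such that for some $\sigma'$ obtained from $\sigma$ by switchings, each at least positive (resp. at least negative) edge of $(G,\sigma')$ maps to an at least positive (resp. at least negative) edge of $(H,\pi)$; $\textsc{List-S-Hom}(H,\pi)$ asks, given $(G,\sigma)$ with lists $L(v)\subseteq V(H)$, whether such $f$ with $f(v)\in L(v)$ exists. For bipartite $H$ with vertices coloured black and white, a bipartite min ordering is a pair of linear orders $<_b$ (black) and $<_w$ (white) such that for white $x<_w x'$ and black $y<_b y'$, if $xy'$ and $x'y$ are edges then $xy$ is an edge; it is special if for black $x,x'$ and white $y,y'$: if $xy$ is bicoloured and $xy'$ unicoloured then $y<_w y'$, and if $xy$ is bicoloured and $x'y$ unicoloured then $x<_b x'$. *)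

theory Defs
  imports Main
begin

section \<open>Signed graphs\<close>

text \<open>
  An edge is unicoloured blue if it lies in \<open>pos\<close> only, unicoloured red if it lies in \<open>neg\<close> only,
  and bicoloured if it lies in both. Thus \<open>pos\<close> consists of the at least positive edges and
  \<open>neg\<close> of the at least negative ones. An undirected edge is present in both orientations.
\<close>

record 'a sgraph =
  verts :: "'a set"
  pos :: "('a \<times> 'a) set"
  neg :: "('a \<times> 'a) set"

definition signed_graph :: "'a sgraph \<Rightarrow> bool" where
  "signed_graph G \<longleftrightarrow> finite (verts G)
     \<and> pos G \<subseteq> verts G \<times> verts G \<and> neg G \<subseteq> verts G \<times> verts G
     \<and> sym (pos G) \<and> sym (neg G)"

definition edges :: "'a sgraph \<Rightarrow> ('a \<times> 'a) set" where
  "edges G = pos G \<union> neg G"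

definition unicoloured :: "'a sgraph \<Rightarrow> ('a \<times> 'a) set" where
  "unicoloured G = (pos G - neg G) \<union> (neg G - pos G)"

definition bicoloured :: "'a sgraph \<Rightarrow> ('a \<times> 'a) set" where
  "bicoloured G = pos G \<inter> neg G"

definition irreflexive :: "'a sgraph \<Rightarrow> bool" where
  "irreflexive G \<longleftrightarrow> irrefl (edges G)"

text \<open>
  A cycle is given by its vertices in cyclic order. Length 1 is a loop. Length 2 is excluded, since
  between two vertices there is at most one unicoloured edge, which would be traversed twice.
\<close>

definition cycle_in :: "('a \<times> 'a) set \<Rightarrow> 'a list \<Rightarrow> bool" where
  "cycle_in E vs \<longleftrightarrow> vs \<noteq> [] \<and> length vs \<noteq> 2 \<and> distinct vs
     \<and> (\<forall>i<length vs. (vs ! i, vs ! (Suc i mod length vs)) \<in> E)"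

definition uni_balanced :: "'a sgraph \<Rightarrow> bool" where
  "uni_balanced G \<longleftrightarrow> (\<forall>vs. cycle_in (unicoloured G) vs \<longrightarrow>
     even (card {i. i < length vs \<and> (vs ! i, vs ! (Suc i mod length vs)) \<in> neg G}))"

definition connected_graph :: "'a set \<Rightarrow> ('a \<times> 'a) set \<Rightarrow> bool" where
  "connected_graph V E \<longleftrightarrow> (\<forall>u\<in>V. \<forall>v\<in>V. (u, v) \<in> E\<^sup>*)"

definition uni_spanning_connected :: "'a sgraph \<Rightarrow> bool" where
  "uni_spanning_connected G \<longleftrightarrow>
     (\<exists>F. F \<subseteq> unicoloured G \<and> sym F \<and> connected_graph (verts G) F)"


section \<open>Special bipartite min orderings\<close>

definition bipartition :: "'a sgraph \<Rightarrow> 'a set \<Rightarrow> 'a set \<Rightarrow> bool" where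
  "bipartition G B W \<longleftrightarrow> B \<union> W = verts G \<and> B \<inter> W = {} \<and> edges G \<subseteq> (B \<times> W) \<union> (W \<times> B)"

definition bipartite_min_ordering ::
    "'a sgraph \<Rightarrow> 'a set \<Rightarrow> 'a set \<Rightarrow> ('a \<times> 'a) set \<Rightarrow> ('a \<times> 'a) set \<Rightarrow> bool" where
  "bipartite_min_ordering G B W ltb ltw \<longleftrightarrow>
     bipartition G B W \<and> strict_linear_order_on B ltb \<and> strict_linear_order_on W ltw \<and>
     (\<forall>x\<in>W. \<forall>x'\<in>W. \<forall>y\<in>B. \<forall>y'\<in>B.
        (x, x') \<in> ltw \<and> (y, y') \<in> ltb \<and> (x, y') \<in> edges G \<and> (x', y) \<in> edges G
        \<longrightarrow> (x, y) \<in> edges G)"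

definition special_bipartite_min_ordering ::
    "'a sgraph \<Rightarrow> 'a set \<Rightarrow> 'a set \<Rightarrow> ('a \<times> 'a) set \<Rightarrow> ('a \<times> 'a) set \<Rightarrow> bool" where
  "special_bipartite_min_ordering G B W ltb ltw \<longleftrightarrow>
     bipartite_min_ordering G B W ltb ltw \<and>
     (\<forall>x\<in>B. \<forall>y\<in>W. \<forall>y'\<in>W.
        (x, y) \<in> bicoloured G \<and> (x, y') \<in> unicoloured G \<longrightarrow> (y, y') \<in> ltw) \<and>
     (\<forall>x\<in>B. \<forall>x'\<in>B. \<forall>y\<in>W.
        (x, y) \<in> bicoloured G \<and> (x', y) \<in> unicoloured G \<longrightarrow> (x, x') \<in> ltb)"


section \<open>Switching and homomorphisms\<close>

text \<open>
  A loop meets \<open>v\<close> with both of its ends, so its sign is negated twice, that is, left unchanged.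
\<close>

definition switch :: "'a \<Rightarrow> 'a sgraph \<Rightarrow> 'a sgraph" where
  "switch v G = G\<lparr>
     pos := {(x, y). if (x = v) \<noteq> (y = v) then (x, y) \<in> neg G else (x, y) \<in> pos G},
     neg := {(x, y). if (x = v) \<noteq> (y = v) then (x, y) \<in> pos G else (x, y) \<in> neg G}\<rparr>"

inductive switchings :: "'a sgraph \<Rightarrow> 'a sgraph \<Rightarrow> bool" for G where
  refl: "switchings G G"
| step: "switchings G G' \<Longrightarrow> v \<in> verts G \<Longrightarrow> switchings G (switch v G')"

definition s_hom :: "'a sgraph \<Rightarrow> 'b sgraph \<Rightarrow> ('a \<Rightarrow> 'b) \<Rightarrow> bool" where
  "s_hom G H f \<longleftrightarrow> (\<forall>v\<in>verts G. f v \<in> verts H) \<and>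
     (\<exists>G'. switchings G G' \<and>
        (\<forall>(u, v)\<in>pos G'. (f u, f v) \<in> pos H) \<and>
        (\<forall>(u, v)\<in>neg G'. (f u, f v) \<in> neg H))"


section \<open>Polynomial time\<close>

text \<open>
  The machine model is that of while programs over binary trees, as in Jones' WHILE language.
  Reading a variable is charged with the size of the tree stored in it, and every operator costs
  one more unit. The size of the value of an expression is thus bounded by the cost of evaluating
  it (lemma \<open>size_eval_le\<close> below), and a Turing machine that stores the variables as strings
  simulates a run of cost \<open>t\<close> in time polynomial in \<open>t\<close> and the size of the input. Conversely,
  a Turing machine configuration is a fixed number of lists (tape halves) and a state, so that one
  step is a constant number of operations at a cost linear in the size of the configuration.
  Polynomial time in this model is therefore the usual class P.
\<close>

datatype tree = Leaf | Node tree tree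

fun left :: "tree \<Rightarrow> tree" where
  "left Leaf = Leaf"
| "left (Node a b) = a"

fun right :: "tree \<Rightarrow> tree" where
  "right Leaf = Leaf"
| "right (Node a b) = b"

fun tree_of_bool :: "bool \<Rightarrow> tree" where
  "tree_of_bool False = Leaf"
| "tree_of_bool True = Node Leaf Leaf"

fun tree_of_list :: "tree list \<Rightarrow> tree" where
  "tree_of_list [] = Leaf"
| "tree_of_list (t # ts) = Node t (tree_of_list ts)"

type_synonym state = "nat \<Rightarrow> tree"

datatype expr =
    EVar nat
  | ELeaf
  | ENode expr expr
  | ELeft expr
  | ERight expr
  | EEq expr expr

fun eval_expr :: "expr \<Rightarrow> state \<Rightarrow> tree" where
  "eval_expr (EVar x) s = s x"
| "eval_expr ELeaf s = Leaf"
| "eval_expr (ENode e f) s = Node (eval_expr e s) (eval_expr f s)"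
| "eval_expr (ELeft e) s = left (eval_expr e s)"
| "eval_expr (ERight e) s = right (eval_expr e s)"
| "eval_expr (EEq e f) s = tree_of_bool (eval_expr e s = eval_expr f s)"

fun expr_cost :: "expr \<Rightarrow> state \<Rightarrow> nat" where
  "expr_cost (EVar x) s = 1 + size (s x)"
| "expr_cost ELeaf s = 1"
| "expr_cost (ENode e f) s = 1 + expr_cost e s + expr_cost f s"
| "expr_cost (ELeft e) s = 1 + expr_cost e s"
| "expr_cost (ERight e) s = 1 + expr_cost e s"
| "expr_cost (EEq e f) s = 1 + expr_cost e s + expr_cost f s"

lemma size_eval_le: "size (eval_expr e s) \<le> expr_cost e s"
proof (induction e)
  case (ELeft e)
  then show ?case by (cases "eval_expr e s") auto
next
  case (ERight e)
  then show ?case by (cases "eval_expr e s") auto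
next
  case (EEq e f)
  then show ?case by (cases "eval_expr e s = eval_expr f s") auto
qed auto

datatype prog =
    Skip
  | Assign nat expr
  | Seq prog prog
  | Cond expr prog prog
  | While expr prog

text \<open>\<open>run p s t s'\<close>: started in state \<open>s\<close>, the program \<open>p\<close> halts in state \<open>s'\<close> at cost \<open>t\<close>.\<close>

inductive run :: "prog \<Rightarrow> state \<Rightarrow> nat \<Rightarrow> state \<Rightarrow> bool" where
  skip: "run Skip s 1 s"
| assign: "run (Assign x e) s (1 + expr_cost e s) (s(x := eval_expr e s))"
| seq: "run p s t s' \<Longrightarrow> run q s' t' s'' \<Longrightarrow> run (Seq p q) s (1 + t + t') s''"
| cond_true: "eval_expr e s \<noteq> Leaf \<Longrightarrow> run p s t s' \<Longrightarrow>
    run (Cond e p q) s (1 + expr_cost e s + t) s'"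
| cond_false: "eval_expr e s = Leaf \<Longrightarrow> run q s t s' \<Longrightarrow>
    run (Cond e p q) s (1 + expr_cost e s + t) s'"
| while_true: "eval_expr e s \<noteq> Leaf \<Longrightarrow> run p s t s' \<Longrightarrow> run (While e p) s' t' s'' \<Longrightarrow>
    run (While e p) s (1 + expr_cost e s + t + t') s''"
| while_false: "eval_expr e s = Leaf \<Longrightarrow> run (While e p) s (1 + expr_cost e s) s"

lemma run_deterministic:
  "run p s t s' \<Longrightarrow> run p s u s'' \<Longrightarrow> t = u \<and> s' = s''"
proof (induction arbitrary: u s'' rule: run.induct)
  case (skip s)
  then show ?case by cases simp
next
  case (assign x e s)
  then show ?case by cases simp
next
  case (seq p s t s1 q t' s2)
  note IH = seq.IH
  from seq.prems show ?case
  proof cases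
    case (seq u1 r u2)
    from IH(1)[OF seq(2)] have *: "t = u1" "s1 = r" by blast+
    from IH(2)[of u2 s''] seq(3) have "t' = u2" "s2 = s''" unfolding * by blast+
    with * seq(1) show ?thesis by blast
  qed
next
  case (cond_true e s p t s1 q)
  note IH = cond_true.IH and nonleaf = cond_true.hyps(1)
  from cond_true.prems show ?case
  proof cases
    case (cond_true u1)
    with IH[OF cond_true(3)] show ?thesis by blast
  next
    case cond_false
    with nonleaf show ?thesis by blast
  qed
next
  case (cond_false e s q t s1 p)
  note IH = cond_false.IH and leaf = cond_false.hyps(1)
  from cond_false.prems show ?case
  proof cases
    case cond_true
    with leaf show ?thesis by blast
  next
    case (cond_false u1)
    with IH[OF cond_false(3)] show ?thesis by blast
  qed
next
  case (while_true e s p t s1 t' s2)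
  note IH = while_true.IH and nonleaf = while_true.hyps(1)
  from while_true.prems show ?case
  proof cases
    case (while_true u1 r u2)
    from IH(1)[OF while_true(3)] have *: "t = u1" "s1 = r" by blast+
    from IH(2)[of u2 s''] while_true(4) have "t' = u2" "s2 = s''" unfolding * by blast+
    with * while_true(1) show ?thesis by blast
  next
    case while_false
    with nonleaf show ?thesis by blast
  qed
next
  case (while_false e s p)
  note leaf = while_false.hyps(1)
  from while_false.prems show ?case
  proof cases
    case while_true
    with leaf show ?thesis by blast
  next
    case while_false
    then show ?thesis by blast
  qed
qed

definition input_state :: "tree \<Rightarrow> state" where
  "input_state t = (\<lambda>_. Leaf)(0 := t)"

text \<open>
  A decision problem consists of a set \<open>I\<close> of instances, a property \<open>Q\<close> of instances, and an
  encoding of instances as trees. Input and answer are passed in variable \<open>0\<close>.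
\<close>

definition polytime_solvable :: "('i \<Rightarrow> tree) \<Rightarrow> 'i set \<Rightarrow> ('i \<Rightarrow> bool) \<Rightarrow> bool" where
  "polytime_solvable enc I Q \<longleftrightarrow>
     (\<exists>p c k. \<forall>x\<in>I. \<exists>t s.
        run p (input_state (enc x)) t s \<and>
        t \<le> c * size (enc x) ^ k + c \<and>
        (s 0 \<noteq> Leaf \<longleftrightarrow> Q x))"


section \<open>The list homomorphism problem\<close>

type_synonym 'h lhom_instance = "nat sgraph \<times> (nat \<Rightarrow> 'h set)"

text \<open>Up to isomorphism, every finite input graph has vertex set \<open>{..<n}\<close>. It may have loops.\<close>

definition lhom_instances :: "'h sgraph \<Rightarrow> 'h lhom_instance set" where
  "lhom_instances H = {(G, L). signed_graph G \<and> verts G = {..<card (verts G)}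
     \<and> (\<forall>v\<in>verts G. L v \<subseteq> verts H)}"

definition has_list_s_hom :: "'h sgraph \<Rightarrow> 'h lhom_instance \<Rightarrow> bool" where
  "has_list_s_hom H = (\<lambda>(G, L). \<exists>f. s_hom G H f \<and> (\<forall>v\<in>verts G. f v \<in> L v))"

text \<open>
  For each vertex \<open>v\<close>, the characteristic vector of \<open>L v\<close> with respect to an enumeration \<open>hs\<close> of
  the vertices of the target, paired with the row of \<open>v\<close> in the adjacency matrices of the at
  least positive and at least negative edges.
\<close>

definition encode_lhom :: "'h list \<Rightarrow> 'h lhom_instance \<Rightarrow> tree" where
  "encode_lhom hs = (\<lambda>(G, L).
     let vs = [0..<card (verts G)] in
     tree_of_list (map (\<lambda>v.
       Node (tree_of_list (map (\<lambda>a. tree_of_bool (a \<in> L v)) hs))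
            (tree_of_list (map (\<lambda>w. Node (tree_of_bool ((v, w) \<in> pos G))
                                         (tree_of_bool ((v, w) \<in> neg G))) vs))) vs))"

text \<open>The target is fixed: the program may depend on it and on the enumeration of its vertices.\<close>

definition list_s_hom_polytime :: "'h sgraph \<Rightarrow> bool" where
  "list_s_hom_polytime H \<longleftrightarrow>
     (\<forall>hs. distinct hs \<and> set hs = verts H \<longrightarrow>
        polytime_solvable (encode_lhom hs) (lhom_instances H) (has_list_s_hom H))"

end

theory Submission
  imports Defs
begin

text \<open>
  Read a homomorphism together with its switching as a map into pairs of a vertex of \<open>H\<close> and a bit,
  and make the resulting binary constraints path consistent: repeatedly replace \<open>R u v\<close> by the
  intersection over all \<open>w\<close> of \<open>R u w O (R v w)\<inverse>\<close>. There is a solution iff no relation becomes empty.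
  For the nontrivial direction, the special ordering and the connectedness of the unicoloured edges
  make the bicoloured edges of \<open>H\<close> a down-set. So the map that picks the least remaining vertex
  everywhere, which is a homomorphism of the underlying graphs by the min ordering, sends an edge to
  a unicoloured one only if all remaining pairs on that edge are unicoloured. As \<open>H\<close> is
  uni-balanced, path consistency then makes the signs of these edges balanced.
\<close>

section \<open>Polynomial bounds\<close>

text \<open>The obstacle is that signs are a global condition: a choice of images that respects all
  edges may still leave a cycle whose signs no switching repairs. What rules this out is that
  relations are kept for all pairs of vertices, not only adjacent ones, and that diagonal relations
  are contained in the identity. If along every edge of a walk the difference of some two-valued
  function of the values is fixed, then consistency fixes it for the relation between the ends as
  well, and on a closed walk it is zero. This one argument, \<open>potential_exists\<close>, is used
  three times: for the potential \<open>\<tau>\<close> that uni-balance yields on \<open>H\<close>,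
  for the colouring chosen on each component of the instance, and for the switching.

  Polynomial time rests on the target being fixed. All relations are subsets of one finite set, so
  operations on them are finite look-up tables, and the number of rounds is bounded by the number of
  pairs that can be lost.\<close>

text \<open>As the base is at least \<open>2\<close>, a single exponent absorbs constants, sums and products.\<close>

definition poly_bounded :: "(tree \<Rightarrow> nat) \<Rightarrow> bool" where
  "poly_bounded B \<longleftrightarrow> (\<exists>k. \<forall>t. B t \<le> (size t + 2) ^ k)"

lemma poly_bounded_mono:
  assumes "poly_bounded B" and "\<And>t. A t \<le> B t"
  shows "poly_bounded A"
  using assms unfolding poly_bounded_def by (meson order_trans)

lemma poly_bounded_const: "poly_bounded (\<lambda>_. c)"
  unfolding poly_bounded_def
proof (intro exI allI)
  fix t :: tree
  have "c \<le> 2 ^ c" by (simp add: less_imp_le)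
  also have "\<dots> \<le> (size t + 2) ^ c" by (rule power_mono) auto
  finally show "c \<le> (size t + 2) ^ c" .
qed

lemma poly_bounded_size: "poly_bounded size"
  unfolding poly_bounded_def by (rule exI[of _ 1]) auto

lemma poly_bounded_mult:
  assumes "poly_bounded A" and "poly_bounded B"
  shows "poly_bounded (\<lambda>t. A t * B t)"
proof -
  obtain j k where "\<And>t. A t \<le> (size t + 2) ^ j" "\<And>t. B t \<le> (size t + 2) ^ k"
    using assms unfolding poly_bounded_def by blast
  then have "A t * B t \<le> (size t + 2) ^ (j + k)" for t
    by (simp add: power_add mult_le_mono)
  then show ?thesis unfolding poly_bounded_def by blast
qed

lemma poly_bounded_add:
  assumes "poly_bounded A" and "poly_bounded B"
  shows "poly_bounded (\<lambda>t. A t + B t)"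
proof -
  obtain j k where A: "\<And>t. A t \<le> (size t + 2) ^ j" and B: "\<And>t. B t \<le> (size t + 2) ^ k"
    using assms unfolding poly_bounded_def by blast
  have "A t + B t \<le> (size t + 2) ^ Suc (max j k)" for t
  proof -
    have "A t \<le> (size t + 2) ^ max j k"
      by (rule order_trans[OF A]) (rule power_increasing, auto)
    moreover have "B t \<le> (size t + 2) ^ max j k"
      by (rule order_trans[OF B]) (rule power_increasing, auto)
    ultimately have "A t + B t \<le> 2 * (size t + 2) ^ max j k" by simp
    also have "\<dots> \<le> (size t + 2) * (size t + 2) ^ max j k" by (rule mult_le_mono1) simp
    finally show ?thesis by simp
  qed
  then show ?thesis unfolding poly_bounded_def by blast
qed

lemma poly_bounded_power:
  assumes "poly_bounded A"
  shows "poly_bounded (\<lambda>t. A t ^ k)"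
  by (induction k) (simp_all add: poly_bounded_const poly_bounded_mult assms)

lemma poly_bounded_comp:
  assumes "poly_bounded B" and "poly_bounded (\<lambda>t. size (f t))"
  shows "poly_bounded (\<lambda>t. B (f t))"
proof -
  obtain k where "\<And>t. B t \<le> (size t + 2) ^ k" using assms unfolding poly_bounded_def by blast
  moreover have "poly_bounded (\<lambda>t. (size (f t) + 2) ^ k)"
    by (intro poly_bounded_power poly_bounded_add poly_bounded_const assms)
  ultimately show ?thesis by (rule poly_bounded_mono[rotated])
qed

lemmas poly_bounded_intros =
  poly_bounded_const poly_bounded_size poly_bounded_mult poly_bounded_add poly_bounded_power

lemma size_left_le: "size (left t) \<le> size t"
  by (cases t) auto

lemma size_right_le: "size (right t) \<le> size t"
  by (cases t) auto

lemma size_le_left_right: "size t \<le> Suc (size (left t) + size (right t))"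
  by (cases t) auto

lemma run_size: "run p s t s' \<Longrightarrow> size (s' x) \<le> size (s x) + t"
proof (induction rule: run.induct)
  case (assign y e s)
  then show ?case using size_eval_le[of e s] by auto
qed auto


section \<open>Renaming of variables\<close>

fun rename_expr :: "(nat \<Rightarrow> nat) \<Rightarrow> expr \<Rightarrow> expr" where
  "rename_expr r (EVar x) = EVar (r x)"
| "rename_expr r ELeaf = ELeaf"
| "rename_expr r (ENode e f) = ENode (rename_expr r e) (rename_expr r f)"
| "rename_expr r (ELeft e) = ELeft (rename_expr r e)"
| "rename_expr r (ERight e) = ERight (rename_expr r e)"
| "rename_expr r (EEq e f) = EEq (rename_expr r e) (rename_expr r f)"

fun rename :: "(nat \<Rightarrow> nat) \<Rightarrow> prog \<Rightarrow> prog" where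
  "rename r Skip = Skip"
| "rename r (Assign x e) = Assign (r x) (rename_expr r e)"
| "rename r (Seq p q) = Seq (rename r p) (rename r q)"
| "rename r (Cond e p q) = Cond (rename_expr r e) (rename r p) (rename r q)"
| "rename r (While e p) = While (rename_expr r e) (rename r p)"

lemma eval_rename_expr: "eval_expr (rename_expr r e) s = eval_expr e (\<lambda>i. s (r i))"
  by (induction e) auto

lemma cost_rename_expr: "expr_cost (rename_expr r e) s = expr_cost e (\<lambda>i. s (r i))"
  by (induction e) auto

text \<open>The state \<open>s'\<close> laid out along \<open>r\<close> over the background
  \<open>s\<close>. Variables outside the range of \<open>r\<close> are the frame that a renamed
  program leaves alone.\<close>

definition renamed_state :: "(nat \<Rightarrow> nat) \<Rightarrow> state \<Rightarrow> state \<Rightarrow> state" where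
  "renamed_state r s s' = (\<lambda>x. if x \<in> range r then s' (inv r x) else s x)"

lemma run_rename:
  assumes "inj r" and "run p s t s'"
  shows "run (rename r p) (renamed_state r z s) t (renamed_state r z s')"
proof -
  have read: "(\<lambda>i. renamed_state r z s (r i)) = s" for s
    using assms(1) by (simp add: renamed_state_def)
  have upd: "renamed_state r z (s(x := v)) = (renamed_state r z s)(r x := v)" for s x v
    using assms(1) by (auto simp: renamed_state_def fun_eq_iff)
  note [simp] = eval_rename_expr cost_rename_expr read
  from assms(2) show ?thesis
  proof (induction rule: run.induct)
    case (skip s)
    show ?case unfolding rename.simps by (rule run.skip)
  next
    case (assign x e s)
    show ?case
      using run.assign[of "r x" "rename_expr r e" "renamed_state r z s"]
      unfolding rename.simps upd by (simp only: eval_rename_expr cost_rename_expr read)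
  next
    case (seq p s t s' q t' s'')
    show ?case using run.seq[OF seq.IH] by simp
  next
    case (cond_true e s p t s' q)
    then show ?case
      using run.cond_true[of "rename_expr r e" "renamed_state r z s"] by simp
  next
    case (cond_false e s q t s' p)
    then show ?case
      using run.cond_false[of "rename_expr r e" "renamed_state r z s"] by simp
  next
    case (while_true e s p t s' t' s'')
    then show ?case
      using run.while_true[of "rename_expr r e" "renamed_state r z s"] by simp
  next
    case (while_false e s p)
    then show ?case
      using run.while_false[of "rename_expr r e" "renamed_state r z s"] by simp
  qed
qed


section \<open>Polynomial-time functions on trees\<close>

text \<open>The start state is arbitrary outside variable \<open>0\<close>, so programs can be run
  one after another without clearing their scratch variables.\<close>

definition computes :: "prog \<Rightarrow> (tree \<Rightarrow> tree) \<Rightarrow> (tree \<Rightarrow> nat) \<Rightarrow> bool" where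
  "computes p f B \<longleftrightarrow> (\<forall>s. \<exists>t s'. run p s t s' \<and> s' 0 = f (s 0) \<and> t \<le> B (s 0))"

definition polytime_fun :: "(tree \<Rightarrow> tree) \<Rightarrow> bool" where
  "polytime_fun f \<longleftrightarrow> (\<exists>p B. poly_bounded B \<and> computes p f B)"

lemma polytime_funE:
  assumes "polytime_fun f"
  obtains p B where "poly_bounded B" "computes p f B"
  using assms unfolding polytime_fun_def by blast

text \<open>A program writes no more than it pays for, so its output is bounded by its input and
  running time. Composition rests on this, as the second program is charged in terms of
  \<open>f t\<close>.\<close>

lemma polytime_fun_size:
  assumes "polytime_fun f"
  shows "poly_bounded (\<lambda>t. size (f t))"
proof -
  obtain p B where B: "poly_bounded B" and p: "computes p f B"
    using assms by (rule polytime_funE)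
  show ?thesis
  proof (rule poly_bounded_mono)
    show "poly_bounded (\<lambda>t. size t + B t)" by (intro poly_bounded_intros B)
    show "size (f t) \<le> size t + B t" for t
      using p[unfolded computes_def, rule_format, of "\<lambda>_. t"] run_size[of p "\<lambda>_. t" _ _ 0]
      by fastforce
  qed
qed

text \<open>\<open>computes\<close> does not say which variables are overwritten. Renaming along an
  injection that fixes \<open>0\<close> and misses \<open>1\<close> turns variable \<open>1\<close>
  into a register that survives the run.\<close>

lemma computes_keeping:
  assumes "computes p f B"
  obtains q where "\<And>s. \<exists>t s'. run q s t s' \<and> s' 0 = f (s 0) \<and> s' 1 = s 1 \<and> t \<le> B (s 0)"
proof
  define r where "r i = (if i = 0 then 0 else Suc i)" for i :: nat
  have r: "inj r" by (auto simp: r_def inj_on_def split: if_splits)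
  have one: "1 \<notin> range r" by (auto simp: r_def)
  have r0: "r 0 = 0" by (simp add: r_def)
  have inv0: "inv r 0 = 0" using inv_f_f[OF r, of 0] by (simp add: r0)
  have zero: "0 \<in> range r" using r0 by (metis rangeI)
  fix s
  obtain t s' where run: "run p (\<lambda>i. s (r i)) t s'" and s': "s' 0 = f (s 0)" "t \<le> B (s 0)"
    using assms[unfolded computes_def, rule_format, of "\<lambda>i. s (r i)"] r0 by auto
  have "renamed_state r s (\<lambda>i. s (r i)) = s"
    by (auto simp: renamed_state_def f_inv_into_f fun_eq_iff)
  with run_rename[OF r run, of s] have "run (rename r p) s t (renamed_state r s s')" by simp
  then show "\<exists>t s'. run (rename r p) s t s' \<and> s' 0 = f (s 0) \<and> s' 1 = s 1 \<and> t \<le> B (s 0)"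
    using s' one zero inv0 by (intro exI[of _ t] exI[of _ "renamed_state r s s'"])
      (auto simp: renamed_state_def)
qed

lemma polytime_fun_expr:
  assumes "\<And>s. eval_expr e s = f (s 0)" and "\<And>s. expr_cost e s = B (s 0)" and "poly_bounded B"
  shows "polytime_fun f"
  unfolding polytime_fun_def
proof (intro exI conjI)
  show "poly_bounded (\<lambda>t. 1 + B t)" by (intro poly_bounded_intros assms)
  show "computes (Assign 0 e) f (\<lambda>t. 1 + B t)"
    unfolding computes_def
    by (intro allI exI conjI, rule run.assign) (auto simp: assms)
qed

lemma tree_of_bool_eq_Leaf [simp]: "tree_of_bool b = Leaf \<longleftrightarrow> \<not> b"
  by (cases b) auto

lemma polytime_fun_comp:
  assumes "polytime_fun g" and "polytime_fun f"
  shows "polytime_fun (\<lambda>t. g (f t))"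
proof -
  obtain p B where B: "poly_bounded B" and p: "computes p f B"
    using assms(2) by (rule polytime_funE)
  obtain q C where C: "poly_bounded C" and q: "computes q g C"
    using assms(1) by (rule polytime_funE)
  have "poly_bounded (\<lambda>t. 1 + B t + C (f t))"
    by (intro poly_bounded_intros B poly_bounded_comp[OF C] polytime_fun_size assms)
  moreover have "computes (Seq p q) (\<lambda>t. g (f t)) (\<lambda>t. 1 + B t + C (f t))"
    unfolding computes_def
  proof
    fix s
    obtain t s' where 1: "run p s t s'" "s' 0 = f (s 0)" "t \<le> B (s 0)"
      using p unfolding computes_def by blast
    obtain u s'' where 2: "run q s' u s''" "s'' 0 = g (s' 0)" "u \<le> C (s' 0)"
      using q unfolding computes_def by blast
    show "\<exists>t s'. run (Seq p q) s t s' \<and> s' 0 = g (f (s 0)) \<and> t \<le> 1 + B (s 0) + C (f (s 0))"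
      using run.seq[OF 1(1) 2(1)] 1 2 by fastforce
  qed
  ultimately show ?thesis unfolding polytime_fun_def by blast
qed

lemma polytime_fun_id: "polytime_fun (\<lambda>t. t)"
  by (rule polytime_fun_expr[where e = "EVar 0" and B = "\<lambda>t. 1 + size t"])
    (simp, simp, intro poly_bounded_intros)

lemma polytime_fun_left:
  assumes "polytime_fun f"
  shows "polytime_fun (\<lambda>t. left (f t))"
proof (rule polytime_fun_comp[OF _ assms])
  show "polytime_fun left"
    by (rule polytime_fun_expr[where e = "ELeft (EVar 0)" and B = "\<lambda>t. 2 + size t"])
      (simp, simp, intro poly_bounded_intros)
qed

lemma polytime_fun_right:
  assumes "polytime_fun f"
  shows "polytime_fun (\<lambda>t. right (f t))"
proof (rule polytime_fun_comp[OF _ assms])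
  show "polytime_fun right"
    by (rule polytime_fun_expr[where e = "ERight (EVar 0)" and B = "\<lambda>t. 2 + size t"])
      (simp, simp, intro poly_bounded_intros)
qed

lemma polytime_fun_Node:
  assumes "polytime_fun f" and "polytime_fun g"
  shows "polytime_fun (\<lambda>t. Node (f t) (g t))"
proof -
  obtain p0 B where B: "poly_bounded B" and p0: "computes p0 f B"
    using assms(1) by (rule polytime_funE)
  obtain p where p: "\<And>s. \<exists>t s'. run p s t s' \<and> s' 0 = f (s 0) \<and> s' 1 = s 1 \<and> t \<le> B (s 0)"
    using computes_keeping[OF p0] by blast
  obtain q0 C where C: "poly_bounded C" and q0: "computes q0 g C"
    using assms(2) by (rule polytime_funE)
  obtain q where q: "\<And>s. \<exists>t s'. run q s t s' \<and> s' 0 = g (s 0) \<and> s' 1 = s 1 \<and> t \<le> C (s 0)"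
    using computes_keeping[OF q0] by blast
  \<comment> \<open>Variable \<open>1\<close> holds the input during \<open>p\<close> and the value
    of \<open>f\<close> during \<open>q\<close>. Variable \<open>2\<close> serves only for the
    exchange between the two runs, so neither has to preserve it.\<close>
  define P where "P = Seq (Assign 1 (EVar 0)) (Seq p (Seq (Assign 2 (EVar 0)) (Seq (Assign 0 (EVar 1))
    (Seq (Assign 1 (EVar 2)) (Seq q (Assign 0 (ENode (EVar 1) (EVar 0))))))))"
  define D where "D t = 20 + 2 * size t + 3 * size (f t) + size (g t) + B t + C t" for t
  have "poly_bounded D"
    unfolding D_def by (intro poly_bounded_intros B C polytime_fun_size assms)
  moreover have "computes P (\<lambda>t. Node (f t) (g t)) D"
    unfolding computes_def
  proof
    fix s :: state
    define s1 where "s1 = s(1 := s 0)"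
    obtain t s2 where 1: "run p s1 t s2" "s2 0 = f (s 0)" "s2 1 = s 0" "t \<le> B (s 0)"
      using p[of s1] by (auto simp: s1_def)
    define s3 where "s3 = s2(2 := f (s 0), 0 := s 0, 1 := f (s 0))"
    obtain u s4 where 2: "run q s3 u s4" "s4 0 = g (s 0)" "s4 1 = f (s 0)" "u \<le> C (s 0)"
      using q[of s3] by (auto simp: s3_def)
    have r1: "run (Assign 1 (EVar 0)) s (2 + size (s 0)) s1"
      using run.assign[of 1 "EVar 0" s] by (simp add: s1_def numeral_eq_Suc)
    have r2: "run (Assign 2 (EVar 0)) s2 (2 + size (f (s 0))) (s2(2 := f (s 0)))"
      using run.assign[of 2 "EVar 0" s2] by (simp add: 1 numeral_eq_Suc)
    have r3: "run (Assign 0 (EVar 1)) (s2(2 := f (s 0))) (2 + size (s 0)) (s2(2 := f (s 0), 0 := s 0))"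
      using run.assign[of 0 "EVar 1" "s2(2 := f (s 0))"]
      by (simp add: 1[unfolded One_nat_def] numeral_eq_Suc)
    have r4: "run (Assign 1 (EVar 2)) (s2(2 := f (s 0), 0 := s 0)) (2 + size (f (s 0))) s3"
      using run.assign[of 1 "EVar 2" "s2(2 := f (s 0), 0 := s 0)"] by (simp add: s3_def numeral_eq_Suc)
    have r5: "run (Assign 0 (ENode (EVar 1) (EVar 0))) s4 (4 + size (f (s 0)) + size (g (s 0)))
        (s4(0 := Node (f (s 0)) (g (s 0))))"
      using run.assign[of 0 "ENode (EVar 1) (EVar 0)" s4]
      by (simp add: 2[unfolded One_nat_def] numeral_eq_Suc)
    note r = run.seq[OF r1 run.seq[OF 1(1) run.seq[OF r2 run.seq[OF r3 run.seq[OF r4 run.seq[OF 2(1) r5]]]]]]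
    show "\<exists>t s'. run P s t s' \<and> s' 0 = Node (f (s 0)) (g (s 0)) \<and> t \<le> D (s 0)"
      by (intro exI conjI, unfold P_def, rule r) (use 1 2 in \<open>auto simp: D_def\<close>)
  qed
  ultimately show ?thesis unfolding polytime_fun_def by blast
qed

lemma polytime_fun_eq:
  assumes "polytime_fun f" and "polytime_fun g"
  shows "polytime_fun (\<lambda>t. tree_of_bool (f t = g t))"
proof -
  have "polytime_fun (\<lambda>t. tree_of_bool (left t = right t))"
    by (rule polytime_fun_expr[where e = "EEq (ELeft (EVar 0)) (ERight (EVar 0))" and B = "\<lambda>t. 5 + 2 * size t"])
      (simp, simp, intro poly_bounded_intros)
  from polytime_fun_comp[OF this polytime_fun_Node[OF assms]] show ?thesis by simp
qed

lemma polytime_fun_if: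
  assumes "polytime_fun c" and "polytime_fun f" and "polytime_fun g"
  shows "polytime_fun (\<lambda>t. if c t = Leaf then g t else f t)"
proof -
  obtain p B where B: "poly_bounded B" and p: "computes p f B"
    using assms(2) by (rule polytime_funE)
  obtain q C where C: "poly_bounded C" and q: "computes q g C"
    using assms(3) by (rule polytime_funE)
  \<comment> \<open>It is enough to branch on a pair of the evaluated condition and the argument.
    Forming this pair is left to \<open>polytime_fun_Node\<close>, which saves the argument while
    the condition is evaluated.\<close>
  define P where "P = Seq (Assign 1 (ELeft (EVar 0))) (Seq (Assign 0 (ERight (EVar 0)))
    (Cond (EVar 1) p q))"
  define D where "D t = 20 + 3 * size t + B (right t) + C (right t)" for t
  have "poly_bounded D"
    unfolding D_def by (intro poly_bounded_intros poly_bounded_comp[OF B] poly_bounded_comp[OF C]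
        polytime_fun_size polytime_fun_right polytime_fun_id)
  moreover have "computes P (\<lambda>t. if left t = Leaf then g (right t) else f (right t)) D"
    unfolding computes_def
  proof
    fix s :: state
    define s1 where "s1 = s(1 := left (s 0))"
    define s2 where "s2 = s1(0 := right (s 0))"
    have r1: "run (Assign 1 (ELeft (EVar 0))) s (3 + size (s 0)) s1"
      using run.assign[of 1 "ELeft (EVar 0)" s] by (simp add: s1_def numeral_eq_Suc)
    have r2: "run (Assign 0 (ERight (EVar 0))) s1 (3 + size (s 0)) s2"
      using run.assign[of 0 "ERight (EVar 0)" s1] by (simp add: s1_def s2_def numeral_eq_Suc)
    obtain t s3 where 1: "run p s2 t s3" "s3 0 = f (right (s 0))" "t \<le> B (right (s 0))"
      using p[unfolded computes_def, rule_format, of s2] by (auto simp: s2_def)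
    obtain u s4 where 2: "run q s2 u s4" "s4 0 = g (right (s 0))" "u \<le> C (right (s 0))"
      using q[unfolded computes_def, rule_format, of s2] by (auto simp: s2_def)
    have s2: "s2 1 = left (s 0)" by (simp add: s2_def s1_def)
    show "\<exists>t s'. run P s t s' \<and> s' 0 = (if left (s 0) = Leaf then g (right (s 0)) else f (right (s 0)))
        \<and> t \<le> D (s 0)"
    proof (cases "left (s 0) = Leaf")
      case True
      then have "run (Cond (EVar 1) p q) s2 (1 + expr_cost (EVar 1) s2 + u) s4"
        by (intro run.cond_false) (simp_all add: s2[unfolded One_nat_def] 2)
      from run.seq[OF r1 run.seq[OF r2 this]] show ?thesis
        unfolding P_def D_def using 2 True s2 by fastforce
    next
      case False
      then have "run (Cond (EVar 1) p q) s2 (1 + expr_cost (EVar 1) s2 + t) s3"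
        by (intro run.cond_true) (simp_all add: s2[unfolded One_nat_def] 1)
      from run.seq[OF r1 run.seq[OF r2 this]] show ?thesis
        unfolding P_def D_def using 1 False s2 size_left_le[of "s 0"] by fastforce
    qed
  qed
  ultimately have "polytime_fun (\<lambda>t. if left t = Leaf then g (right t) else f (right t))"
    unfolding polytime_fun_def by blast
  from polytime_fun_comp[OF this polytime_fun_Node[OF assms(1) polytime_fun_id]]
  show ?thesis by (simp only: left.simps right.simps)
qed

lemma polytime_fun_const: "polytime_fun (\<lambda>_. c)"
proof (induction c)
  case Leaf
  show ?case
    by (rule polytime_fun_expr[where e = ELeaf and B = "\<lambda>_. 1"]) (auto intro: poly_bounded_intros)
qed (rule polytime_fun_Node)

lemmas polytime_fun_intros = polytime_fun_const polytime_fun_id polytime_fun_left polytime_fun_right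
  polytime_fun_Node polytime_fun_eq polytime_fun_if

text \<open>A look-up table: on a finite set \<open>h\<close> may be any function, its values being
  constants of the program. All operations on relations over the fixed target enter in this
  way.\<close>

definition on_finite :: "tree set \<Rightarrow> (tree \<Rightarrow> tree) \<Rightarrow> tree \<Rightarrow> tree" where
  "on_finite A h t = (if t \<in> A then h t else Leaf)"

lemma polytime_fun_on_finite:
  assumes "finite A" and f: "polytime_fun f"
  shows "polytime_fun (\<lambda>t. on_finite A h (f t))"
proof (rule polytime_fun_comp[OF _ f])
  from assms(1) show "polytime_fun (on_finite A h)"
  proof (induction A rule: finite_induct)
    case empty
    show ?case unfolding on_finite_def by (simp add: polytime_fun_const)
  next
    case (insert a A)
    have "polytime_fun (\<lambda>t. if tree_of_bool (t = a) = Leaf then on_finite A h t else h a)"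
      by (intro polytime_fun_intros insert.IH)
    moreover have "(\<lambda>t. if tree_of_bool (t = a) = Leaf then on_finite A h t else h a)
        = on_finite (insert a A) h"
      using insert.hyps by (auto simp: fun_eq_iff on_finite_def)
    ultimately show ?case by simp
  qed
qed

lemma on_finite_bounded:
  assumes "finite A"
  obtains b where "\<And>t. size (on_finite A h t) \<le> b"
proof
  show "size (on_finite A h t) \<le> Max (insert 0 ((\<lambda>t. size (h t)) ` A))" for t
    using assms by (auto simp: on_finite_def)
qed


section \<open>Loops over lists\<close>

fun spine :: "tree \<Rightarrow> nat" where
  "spine Leaf = 0"
| "spine (Node a b) = Suc (spine b)"

lemma spine_le_size: "spine t \<le> size t"
  by (induction t) auto

text \<open>Iterating a polynomial-time function may blow up its values exponentially, hence the
  separate hypothesis \<open>bound\<close> on all intermediate values. The loop counter is the list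
  in the left component, which loses one cell per round.\<close>

lemma polytime_fun_loop:
  assumes f: "polytime_fun f" and counter: "\<And>t. left (f t) = right (left t)"
    and C: "poly_bounded C" and bound: "\<And>t i. i \<le> spine (left t) \<Longrightarrow> size ((f ^^ i) t) \<le> C t"
  shows "polytime_fun (\<lambda>t. (f ^^ spine (left t)) t)"
proof -
  obtain p B where B: "poly_bounded B" and p: "computes p f B"
    using f by (rule polytime_funE)
  \<comment> \<open>\<open>B\<close> need not be monotone in the size. The power is, and so it
    bounds the cost of every round in terms of a common size bound \<open>b\<close>.\<close>
  obtain k where k: "\<And>t. B t \<le> (size t + 2) ^ k" using B unfolding poly_bounded_def by blast
  let ?W = "While (ELeft (EVar 0)) p"
  have *: "\<exists>t s'. run ?W s t s' \<and> s' 0 = (f ^^ n) (s 0) \<and> t \<le> (n + 1) * (b + 3 + (b + 2) ^ k)"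
    if "spine (left (s 0)) = n" "\<And>i. i \<le> n \<Longrightarrow> size ((f ^^ i) (s 0)) \<le> b" for s n b
    using that
  proof (induction n arbitrary: s)
    case 0
    then have "left (s 0) = Leaf" by (cases "left (s 0)") auto
    then have "run ?W s (1 + expr_cost (ELeft (EVar 0)) s) s"
      by (intro run.while_false) simp
    then show ?case using 0(2)[of 0] by (intro exI[of _ "1 + expr_cost (ELeft (EVar 0)) s"] exI[of _ s]) auto
  next
    case (Suc n)
    then have left: "left (s 0) \<noteq> Leaf" by (cases "left (s 0)") auto
    obtain t s' where 1: "run p s t s'" "s' 0 = f (s 0)" "t \<le> B (s 0)"
      using p unfolding computes_def by blast
    have "spine (left (s' 0)) = n"
      using Suc.prems(1) left by (cases "left (s 0)") (auto simp: 1 counter)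
    moreover have "size ((f ^^ i) (s' 0)) \<le> b" if "i \<le> n" for i
      using Suc.prems(2)[of "Suc i"] that by (simp add: 1 funpow_swap1)
    ultimately obtain u s'' where 2: "run ?W s' u s''" "s'' 0 = (f ^^ n) (s' 0)"
      "u \<le> (n + 1) * (b + 3 + (b + 2) ^ k)"
      using Suc.IH by blast
    have "size (s 0) \<le> b" using Suc.prems(2)[of 0] by simp
    then have "t \<le> (b + 2) ^ k"
      using 1(3) k[of "s 0"] power_mono[of "size (s 0) + 2" "b + 2" k] by linarith
    moreover have "run ?W s (1 + expr_cost (ELeft (EVar 0)) s + t + u) s''"
      using left by (intro run.while_true[OF _ 1(1) 2(1)]) simp
    ultimately show ?case using 2 1 \<open>size (s 0) \<le> b\<close>
      by (intro exI[of _ "1 + expr_cost (ELeft (EVar 0)) s + t + u"] exI[of _ s''])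
        (auto simp: funpow_swap1)
  qed
  show ?thesis
    unfolding polytime_fun_def
  proof (intro exI conjI)
    show "poly_bounded (\<lambda>t. (size t + 1) * (C t + 3 + (C t + 2) ^ k))"
      by (intro poly_bounded_intros C)
    show "computes ?W (\<lambda>t. (f ^^ spine (left t)) t) (\<lambda>t. (size t + 1) * (C t + 3 + (C t + 2) ^ k))"
      unfolding computes_def
    proof
      fix s :: state
      have "spine (left (s 0)) \<le> size (s 0)"
        using spine_le_size size_left_le order_trans by blast
      then have "(spine (left (s 0)) + 1) * (C (s 0) + 3 + (C (s 0) + 2) ^ k)
          \<le> (size (s 0) + 1) * (C (s 0) + 3 + (C (s 0) + 2) ^ k)"
        by (intro mult_le_mono1) simp
      then show "\<exists>t s'. run ?W s t s' \<and> s' 0 = (f ^^ spine (left (s 0))) (s 0)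
          \<and> t \<le> (size (s 0) + 1) * (C (s 0) + 3 + (C (s 0) + 2) ^ k)"
        using *[of s "spine (left (s 0))" "C (s 0)"] bound[of _ "s 0"] by (meson order_trans)
    qed
  qed
qed

text \<open>The step function sees the remaining suffixes instead of the heads, because
  \<open>init_tree\<close> has to recognise positions. The second list runs along and is padded with
  \<open>Leaf\<close>. Parameters are passed as data in \<open>e\<close>, since \<open>F\<close>
  itself is fixed in the program.\<close>

fun fold2 :: "(tree \<Rightarrow> tree \<Rightarrow> tree \<Rightarrow> tree \<Rightarrow> tree) \<Rightarrow> tree \<Rightarrow> tree \<Rightarrow> tree \<Rightarrow> tree \<Rightarrow> tree" where
  "fold2 F e a Leaf ys = a"
| "fold2 F e a (Node x xs) ys = fold2 F e (F e a (Node x xs) ys) xs (right ys)"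

text \<open>The increment \<open>G\<close> does not depend on the accumulator. So the accumulator
  gains at most one and the same polynomial amount in each round, which meets the size condition of
  \<open>polytime_fun_loop\<close>.\<close>

lemma polytime_fun_fold2:
  assumes F: "polytime_fun (\<lambda>t. F (left t) (left (right t)) (left (right (right t))) (right (right (right t))))"
    and G: "poly_bounded G"
    and growth: "\<And>e a x y. size (F e a x y) \<le> size a + G (Node e (Node x y))"
    and args: "polytime_fun e" "polytime_fun a" "polytime_fun x" "polytime_fun y"
  shows "polytime_fun (\<lambda>t. fold2 F (e t) (a t) (x t) (y t))"
proof -
  let ?x = "left" and ?y = "\<lambda>t. left (right t)"
    and ?e = "\<lambda>t. left (right (right t))" and ?a = "\<lambda>t. right (right (right t))"
  define f where "f t = Node (right (?x t)) (Node (right (?y t)) (Node (?e t) (F (?e t) (?a t) (?x t) (?y t))))" for t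
  obtain k where k: "\<And>t. G t \<le> (size t + 2) ^ k" using G unfolding poly_bounded_def by blast
  have "polytime_fun (\<lambda>t. F (?e t) (?a t) (?x t) (?y t))"
    using polytime_fun_comp[OF F, of "\<lambda>t. Node (?e t) (Node (?a t) (Node (?x t) (?y t)))"]
    by (simp add: polytime_fun_intros)
  then have "polytime_fun f" unfolding f_def by (intro polytime_fun_intros)
  \<comment> \<open>The argument of \<open>G\<close> has two more nodes than its three parts
    together, and \<open>poly_bounded\<close> adds \<open>2\<close>, hence the \<open>4\<close>. As
    the lists only shrink, \<open>g\<close> bounds the increment in all rounds.\<close>
  moreover define g where "g t = (size (?e t) + size (?x t) + size (?y t) + 4) ^ k" for t
  have inv: "size (?x ((f ^^ i) t)) \<le> size (?x t) \<and> size (?y ((f ^^ i) t)) \<le> size (?y t)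
      \<and> ?e ((f ^^ i) t) = ?e t \<and> size (?a ((f ^^ i) t)) \<le> size (?a t) + i * g t" for i t
  proof (induction i)
    case (Suc i)
    let ?t = "(f ^^ i) t"
    have "G (Node (?e ?t) (Node (?x ?t) (?y ?t))) \<le> g t"
      using Suc.IH by (intro order_trans[OF k]) (auto simp: g_def intro!: power_mono)
    then have "size (F (?e ?t) (?a ?t) (?x ?t) (?y ?t)) \<le> size (?a ?t) + g t"
      using growth[of "?e ?t" "?a ?t" "?x ?t" "?y ?t"] by linarith
    moreover have "size (right (?x ?t)) \<le> size (?x t)" "size (right (?y ?t)) \<le> size (?y t)"
      using Suc.IH size_right_le order_trans by blast+
    moreover have "?x (f ?t) = right (?x ?t)" "?y (f ?t) = right (?y ?t)" "?e (f ?t) = ?e ?t"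
      "?a (f ?t) = F (?e ?t) (?a ?t) (?x ?t) (?y ?t)"
      by (simp_all add: f_def)
    ultimately show ?case using Suc.IH by simp
  qed simp
  have "poly_bounded (\<lambda>t. 3 + (size (?x t) + size (?y t) + size (?e t) + size (?a t)) + size t * g t)"
    unfolding g_def by (intro poly_bounded_intros polytime_fun_size polytime_fun_intros)
  moreover have "size ((f ^^ i) t)
      \<le> 3 + (size (?x t) + size (?y t) + size (?e t) + size (?a t)) + size t * g t"
    if "i \<le> spine (left t)" for t i
  proof -
    let ?t = "(f ^^ i) t"
    have "size ?t \<le> 3 + (size (?x ?t) + size (?y ?t) + size (?e ?t) + size (?a ?t))"
      using size_le_left_right[of ?t] size_le_left_right[of "right ?t"]
        size_le_left_right[of "right (right ?t)"] by linarith
    moreover have "i \<le> size t" using that spine_le_size[of "left t"] size_left_le[of t] by linarith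
    then have "i * g t \<le> size t * g t" by (rule mult_le_mono1)
    moreover note inv[where i = i and t = t]
    moreover from calculation have "size (?e ?t) = size (?e t)" by simp
    ultimately show ?thesis by linarith
  qed
  moreover have "left (f t) = right (left t)" for t by (simp add: f_def)
  ultimately have loop: "polytime_fun (\<lambda>t. (f ^^ spine (left t)) t)"
    by (intro polytime_fun_loop)
  have "f (Node (Node x xs) (Node ys (Node e a)))
      = Node xs (Node (right ys) (Node e (F e a (Node x xs) ys)))" for x xs ys e a
    by (simp add: f_def)
  then have "?a ((f ^^ spine xs) (Node xs (Node ys (Node e a)))) = fold2 F e a xs ys" for xs ys e a
    by (induction xs arbitrary: ys a) (simp_all add: funpow_Suc_right del: funpow.simps(2))
  then have "(\<lambda>t. fold2 F (e t) (a t) (x t) (y t))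
      = (\<lambda>t. ?a ((\<lambda>t. (f ^^ spine (left t)) t) (Node (x t) (Node (y t) (Node (e t) (a t))))))"
    by simp
  moreover have "polytime_fun \<dots>"
    by (rule polytime_fun_right polytime_fun_comp[OF loop] polytime_fun_Node args)+
  ultimately show ?thesis by simp
qed

section \<open>Maps over the suffixes of two lists\<close>

fun rev_append :: "tree \<Rightarrow> tree \<Rightarrow> tree" where
  "rev_append Leaf ys = ys"
| "rev_append (Node x xs) ys = rev_append xs (Node x ys)"

lemma rev_append_fold2: "rev_append xs a = fold2 (\<lambda>_ a xs _. Node (left xs) a) Leaf a xs Leaf"
  by (induction xs a rule: rev_append.induct) auto


fun map2_suffix :: "(tree \<Rightarrow> tree \<Rightarrow> tree \<Rightarrow> tree) \<Rightarrow> tree \<Rightarrow> tree \<Rightarrow> tree \<Rightarrow> tree" where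
  "map2_suffix F e Leaf ys = Leaf"
| "map2_suffix F e (Node x xs) ys = Node (F e (Node x xs) ys) (map2_suffix F e xs (right ys))"

lemma map2_suffix_fold2:
  "map2_suffix F e xs ys
     = rev_append (fold2 (\<lambda>e a xs ys. Node (F e xs ys) a) e Leaf xs ys) Leaf"
proof -
  have "rev_append (fold2 (\<lambda>e a xs ys. Node (F e xs ys) a) e a xs ys) Leaf
      = rev_append a (map2_suffix F e xs ys)" for a
    by (induction F e xs ys arbitrary: a rule: map2_suffix.induct) auto
  from this[of Leaf] show ?thesis by simp
qed

lemma polytime_fun_map2_suffix:
  assumes F: "polytime_fun (\<lambda>t. F (left t) (left (right t)) (right (right t)))"
    and args: "polytime_fun e" "polytime_fun x" "polytime_fun y"
  shows "polytime_fun (\<lambda>t. map2_suffix F (e t) (x t) (y t))"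
proof -
  have F': "polytime_fun (\<lambda>t. F (left t) (left (right (right t))) (right (right (right t))))"
    using polytime_fun_comp[OF F, of "\<lambda>t. Node (left t) (right (right t))"]
    by (simp add: polytime_fun_intros)
  have "polytime_fun (\<lambda>t. fold2 (\<lambda>e a xs ys. Node (F e xs ys) a) (e t) Leaf (x t) (y t))"
  proof (rule polytime_fun_fold2)
    show "poly_bounded (\<lambda>t. Suc (size (F (left t) (left (right t)) (right (right t)))))"
      using poly_bounded_add[OF poly_bounded_const[of 1] polytime_fun_size[OF F]] by simp
  qed (auto intro!: polytime_fun_intros F' args)
  note fold = this
  have "polytime_fun (\<lambda>t. fold2 (\<lambda>_ a xs _. Node (left xs) a) Leaf Leaf
      (fold2 (\<lambda>e a xs ys. Node (F e xs ys) a) (e t) Leaf (x t) (y t)) Leaf)"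
  proof (rule polytime_fun_fold2)
    show "poly_bounded (\<lambda>t. 1 + size t)" by (intro poly_bounded_intros)
    show "size (Node (left x) a) \<le> size a + (1 + size (Node e (Node x y)))" for e a x y
      using size_left_le[of x] by simp
  qed (intro polytime_fun_intros fold)+
  then show ?thesis by (simp add: map2_suffix_fold2 rev_append_fold2)
qed

lemma spine_map2_suffix: "spine (map2_suffix F e xs ys) = spine xs"
  by (induction F e xs ys rule: map2_suffix.induct) auto

text \<open>The bound involves only the number of entries of the argument, not their sizes. This
  keeps matrices from growing when they are rebuilt again and again.\<close>

lemma size_map2_suffix:
  assumes "\<And>x y. size (F e x y) \<le> b"
  shows "size (map2_suffix F e xs ys) \<le> Suc b * spine xs"
proof (induction xs arbitrary: ys)
  case (Node x xs)
  show ?case using assms[of "Node x xs" ys] Node.IH(2)[of "right ys"] by simp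
qed simp

lemma map2_suffix_tree_of_list:
  "map2_suffix F e (tree_of_list xs) (tree_of_list ys)
     = tree_of_list (map (\<lambda>i. F e (tree_of_list (drop i xs)) (tree_of_list (drop i ys))) [0..<length xs])"
proof (induction xs arbitrary: ys)
  case (Cons x xs)
  have "right (tree_of_list ys) = tree_of_list (tl ys)" by (cases ys) auto
  moreover have "map g [0..<Suc n] = g 0 # map (\<lambda>i. g (Suc i)) [0..<n]" for g :: "nat \<Rightarrow> tree" and n
    by (subst upt_conv_Cons) (auto simp: map_Suc_upt[symmetric] simp del: upt_Suc)
  ultimately show ?case by (simp add: Cons.IH drop_Suc del: upt_Suc)
qed simp

lemma left_tree_of_list_drop: "i < length xs \<Longrightarrow> left (tree_of_list (drop i xs)) = xs ! i"
  by (simp add: Cons_nth_drop_Suc[symmetric])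

lemma tree_of_list_inj: "tree_of_list xs = tree_of_list ys \<longleftrightarrow> xs = ys"
proof (induction xs arbitrary: ys)
  case Nil
  show ?case by (cases ys) auto
next
  case (Cons x xs)
  then show ?case by (cases ys) auto
qed

section \<open>Matrices of relations\<close>

definition matrix_tree :: "nat \<Rightarrow> (nat \<Rightarrow> nat \<Rightarrow> tree) \<Rightarrow> tree" where
  "matrix_tree n E = tree_of_list (map (\<lambda>u. tree_of_list (map (E u) [0..<n])) [0..<n])"

lemma matrix_tree_cong:
  "(\<And>u v. u < n \<Longrightarrow> v < n \<Longrightarrow> E u v = E' u v) \<Longrightarrow> matrix_tree n E = matrix_tree n E'"
  unfolding matrix_tree_def by (auto intro!: arg_cong[where f = tree_of_list])

text \<open>
  \<open>U\<close> and \<open>V\<close> are suffixes of the list of vertices, hence equal iff they start at the same vertex.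
  Their first entries would not tell apart vertices with equal lists and rows.
\<close>

definition init_tree :: "tree set \<Rightarrow> (tree \<Rightarrow> tree) \<Rightarrow> tree \<Rightarrow> tree" where
  "init_tree A g T = map2_suffix (\<lambda>T U _. map2_suffix (\<lambda>U V y. on_finite A g
     (Node (Node (left (left U)) (left (left V))) (Node (left y) (tree_of_bool (U = V)))))
     U T (right (left U))) T T Leaf"

text \<open>An inner product of two rows. With \<open>h\<close> the table of
  \<open>a \<inter> (b O c\<inverse>)\<close> and \<open>i\<close> the full relation, it is one
  entry of \<open>refine\<close>.\<close>

definition dot_tree :: "tree set \<Rightarrow> (tree \<Rightarrow> tree) \<Rightarrow> tree \<Rightarrow> tree \<Rightarrow> tree \<Rightarrow> tree" where
  "dot_tree A h i r r' = fold2 (\<lambda>_ a x y. on_finite A h (Node a (Node (left x) (left y)))) Leaf i r r'"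

definition step_tree :: "tree set \<Rightarrow> (tree \<Rightarrow> tree) \<Rightarrow> tree \<Rightarrow> tree \<Rightarrow> tree" where
  "step_tree A h i M = map2_suffix (\<lambda>M U _. map2_suffix (\<lambda>r V _. dot_tree A h i r (left V))
     (left U) M Leaf) M M Leaf"

text \<open>Loops run along lists, so the number of rounds has to be written down in unary. With
  \<open>k\<close> the size of the full relation, the length is the largest number of pairs that the
  whole matrix can hold.\<close>

definition counter_tree :: "nat \<Rightarrow> tree \<Rightarrow> tree" where
  "counter_tree k T = fold2 (\<lambda>T a _ _. fold2 (\<lambda>_ a _ _. (Node Leaf ^^ k) a) Leaf a T Leaf) T Leaf T Leaf"

definition iterate_tree :: "tree set \<Rightarrow> (tree \<Rightarrow> tree) \<Rightarrow> tree \<Rightarrow> tree \<Rightarrow> tree" where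
  "iterate_tree A h i t = Node (right (left t)) (step_tree A h i (right t))"

text \<open>\<open>b\<close> stands for the empty relation. Looking at the first column is enough:
  in a consistent matrix, an empty entry at \<open>(v, v)\<close> forces the entry at
  \<open>(v, 0)\<close> to be empty.\<close>

definition check_tree :: "tree \<Rightarrow> tree \<Rightarrow> tree" where
  "check_tree b M = fold2 (\<lambda>_ a x _. if tree_of_bool (left (left x) = b) = Leaf then a else Leaf)
     Leaf (Node Leaf Leaf) M Leaf"

definition solve_tree ::
    "tree set \<Rightarrow> (tree \<Rightarrow> tree) \<Rightarrow> tree set \<Rightarrow> (tree \<Rightarrow> tree) \<Rightarrow> tree \<Rightarrow> nat \<Rightarrow> tree \<Rightarrow> tree \<Rightarrow> tree" where
  "solve_tree A g A' h i k b T = (let t = Node (counter_tree k T) (init_tree A g T)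
     in check_tree b (right ((iterate_tree A' h i ^^ spine (left t)) t)))"

section \<open>Running times of the tree functions\<close>

lemma polytime_fun_init_tree: "finite A \<Longrightarrow> polytime_fun (init_tree A g)"
  unfolding init_tree_def
  by (intro polytime_fun_map2_suffix polytime_fun_on_finite polytime_fun_intros)

lemma polytime_fun_dot_tree:
  assumes "finite A" and "polytime_fun r" and "polytime_fun r'"
  shows "polytime_fun (\<lambda>t. dot_tree A h i (r t) (r' t))"
proof -
  obtain b where b: "\<And>t. size (on_finite A h t) \<le> b"
    using on_finite_bounded[OF assms(1)] by blast
  show ?thesis
    unfolding dot_tree_def
  proof (rule polytime_fun_fold2)
    show "poly_bounded (\<lambda>_. b)" by (rule poly_bounded_const)
  qed (use b in \<open>auto intro!: polytime_fun_on_finite polytime_fun_intros assms trans_le_add2\<close>)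
qed

lemma polytime_fun_step_tree: "finite A \<Longrightarrow> polytime_fun (step_tree A h i)"
  unfolding step_tree_def
  by (intro polytime_fun_map2_suffix polytime_fun_dot_tree polytime_fun_intros)

lemma size_fold2_add:
  assumes "\<And>e a x y. size (F e a x y) \<le> size a + k"
  shows "size (fold2 F e a xs ys) \<le> size a + k * spine xs"
proof (induction xs arbitrary: a ys)
  case (Node x xs)
  show ?case
    using Node.IH(2)[of "F e a (Node x xs) ys" "right ys"] assms[of e a "Node x xs" ys] by simp
qed simp

lemma spine_fold2_add:
  assumes "\<And>a x y. spine (F e a x y) = spine a + k"
  shows "spine (fold2 F e a xs ys) = spine a + k * spine xs"
  by (induction xs arbitrary: a ys) (auto simp: assms)

lemma size_Node_Leaf_funpow: "size ((Node Leaf ^^ k) a) = size a + k"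
  by (induction k) auto

lemma spine_Node_Leaf_funpow: "spine ((Node Leaf ^^ k) a) = spine a + k"
  by (induction k) auto

lemma polytime_fun_counter_tree: "polytime_fun (counter_tree k)"
proof -
  have k: "polytime_fun (\<lambda>t. (Node Leaf ^^ k) (f t))" if "polytime_fun f" for f
    by (induction k) (simp_all add: that polytime_fun_Node polytime_fun_const)
  have inner: "polytime_fun (\<lambda>t. fold2 (\<lambda>_ a _ _. (Node Leaf ^^ k) a) Leaf (a t) (T t) Leaf)"
    if "polytime_fun a" "polytime_fun T" for a T
    by (rule polytime_fun_fold2[where G = "\<lambda>_. k"])
      (use that in \<open>auto simp: size_Node_Leaf_funpow intro!: k polytime_fun_intros poly_bounded_intros\<close>)
  show ?thesis
    unfolding counter_tree_def
  proof (rule polytime_fun_fold2)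
    show "poly_bounded (\<lambda>t. k * size t)" by (intro poly_bounded_intros)
    show "size (fold2 (\<lambda>_ a _ _. (Node Leaf ^^ k) a) Leaf a e Leaf) \<le> size a + k * size (Node e (Node x y))"
      for a e x y
    proof -
      have "k * spine e \<le> k * size (Node e (Node x y))"
        using spine_le_size[of e] by (intro mult_le_mono2) simp
      then show ?thesis
        using size_fold2_add[of "\<lambda>_ a _ _. (Node Leaf ^^ k) a" k Leaf a e Leaf]
        by (simp add: size_Node_Leaf_funpow)
    qed
  qed (intro inner polytime_fun_intros)+
qed

lemma spine_counter_tree: "spine (counter_tree k T) = k * spine T * spine T"
  unfolding counter_tree_def
  by (subst spine_fold2_add[where k = "k * spine T"])
    (simp_all add: spine_fold2_add[where k = k] spine_Node_Leaf_funpow)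

lemma spine_step_tree: "spine (step_tree A h i M) = spine M"
  by (simp add: step_tree_def spine_map2_suffix)

text \<open>The accumulator is the constant \<open>i\<close> at the start and a value of the table
  after every step, so the rows do not enter the bound.\<close>

lemma size_dot_tree:
  assumes "finite A"
  obtains b where "\<And>r r'. size (dot_tree A h i r r') \<le> b"
proof -
  obtain c where c: "\<And>t. size (on_finite A h t) \<le> c"
    using on_finite_bounded[OF assms] by blast
  have "size (fold2 (\<lambda>_ a x y. on_finite A h (Node a (Node (left x) (left y)))) e a r r') \<le> max c (size a)"
    for e a r r'
  proof (induction r arbitrary: a r')
    case (Node x r)
    show ?case
      using c[of "Node a (Node x (left r'))"] Node.IH(2)[of "on_finite A h (Node a (Node x (left r')))" "right r'"]
      by (simp add: max_def split: if_splits)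
  qed simp
  then show ?thesis using that unfolding dot_tree_def by blast
qed

text \<open>Each step builds a new matrix from entries of constant size, and the number of rows
  never changes. Sizes therefore do not accumulate over the rounds.\<close>

lemma polytime_fun_iterate_tree:
  assumes "finite A"
  shows "polytime_fun (\<lambda>t. (iterate_tree A h i ^^ spine (left t)) t)"
proof -
  obtain b where b: "\<And>r r'. size (dot_tree A h i r r') \<le> b"
    using size_dot_tree[OF assms] by blast
  have step: "size (step_tree A h i M) \<le> Suc (Suc b * spine M) * spine M" for M
    unfolding step_tree_def by (intro size_map2_suffix b)
  show ?thesis
  proof (rule polytime_fun_loop)
    show "polytime_fun (iterate_tree A h i)"
      unfolding iterate_tree_def
      by (intro polytime_fun_intros polytime_fun_comp[OF polytime_fun_step_tree] assms)
    show "left (iterate_tree A h i t) = right (left t)" for t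
      by (simp add: iterate_tree_def)
    show "poly_bounded (\<lambda>t. 1 + 2 * size t + Suc (Suc b * size t) * size t)"
      unfolding Suc_eq_plus1 by (intro poly_bounded_intros)
    have sel: "left (iterate_tree A h i t) = right (left t)"
      "right (iterate_tree A h i t) = step_tree A h i (right t)" for t
      by (simp_all add: iterate_tree_def)
    show "size ((iterate_tree A h i ^^ j) t) \<le> 1 + 2 * size t + Suc (Suc b * size t) * size t" for j t
    proof -
      have "size (left ((iterate_tree A h i ^^ j) t)) \<le> size t
          \<and> spine (right ((iterate_tree A h i ^^ j) t)) = spine (right t)
          \<and> (size (right ((iterate_tree A h i ^^ j) t)) \<le> size t + Suc (Suc b * size t) * size t)"
      proof (induction j)
        case 0
        show ?case using size_left_le[of t] size_right_le[of t] by simp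
      next
        case (Suc j)
        let ?t = "(iterate_tree A h i ^^ j) t"
        have *: "spine (right ?t) \<le> size t"
          using Suc.IH spine_le_size[of "right t"] size_right_le[of t] by linarith
        have "size (step_tree A h i (right ?t)) \<le> Suc (Suc b * spine (right ?t)) * spine (right ?t)"
          by (rule step)
        also have "\<dots> \<le> Suc (Suc b * size t) * size t"
          by (intro mult_le_mono Suc_le_mono[THEN iffD2] * le_refl)
        finally show ?case
          using Suc.IH size_right_le[of "left ?t"] sel[of ?t] by (simp add: spine_step_tree)
      qed
      then show ?thesis using size_le_left_right[of "(iterate_tree A h i ^^ j) t"] by linarith
    qed
  qed
qed

lemma polytime_fun_check_tree: "polytime_fun (check_tree b)"
  unfolding check_tree_def
proof (rule polytime_fun_fold2[where G = "\<lambda>_. 0"])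
  show "size (if tree_of_bool (left (left x) = b) = Leaf then a else Leaf) \<le> size a + 0" for x a
    by simp
qed (intro polytime_fun_intros poly_bounded_intros)+

lemma polytime_fun_solve_tree:
  assumes "finite A" and "finite A'"
  shows "polytime_fun (solve_tree A g A' h i k b)"
  unfolding solve_tree_def Let_def
  by (intro polytime_fun_comp[OF polytime_fun_check_tree] polytime_fun_right
      polytime_fun_comp[OF polytime_fun_iterate_tree] polytime_fun_Node
      polytime_fun_counter_tree polytime_fun_init_tree assms)

section \<open>Meaning of the tree functions on matrices\<close>

lemma drop_upt_eq_iff: "u < n \<Longrightarrow> v < n \<Longrightarrow> length xs = n \<Longrightarrow> drop u xs = drop v xs \<longleftrightarrow> u = v"
  by (metis diff_diff_cancel length_drop less_imp_le)

lemma init_tree_eq: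
  "init_tree A g (tree_of_list (map (\<lambda>v. Node (l v) (tree_of_list (map (e v) [0..<n]))) [0..<n]))
     = matrix_tree n (\<lambda>u v. on_finite A g (Node (Node (l u) (l v)) (Node (e u v) (tree_of_bool (u = v)))))"
proof -
  define R where "R v = Node (l v) (tree_of_list (map (e v) [0..<n]))" for v
  have R: "left (R u) = l u" "right (R u) = tree_of_list (map (e u) [0..<n])" for u
    by (simp_all add: R_def)
  have suffix: "left (tree_of_list (drop u (map R [0..<n]))) = R u" if "u < n" for u
    using that by (simp add: left_tree_of_list_drop del: drop_map)
  have entry: "left (tree_of_list (drop v (map (e u) [0..<n]))) = e u v" if "v < n" for u v
    using that by (simp add: left_tree_of_list_drop del: drop_map)
  have eq: "tree_of_list (drop u (map R [0..<n])) = tree_of_list (drop v (map R [0..<n])) \<longleftrightarrow> u = v"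
    if "u < n" "v < n" for u v
    using drop_upt_eq_iff[OF that, of "map R [0..<n]"] by (simp add: tree_of_list_inj del: drop_map)
  have "init_tree A g (tree_of_list (map R [0..<n]))
      = matrix_tree n (\<lambda>u v. on_finite A g (Node (Node (l u) (l v)) (Node (e u v) (tree_of_bool (u = v)))))"
    unfolding init_tree_def matrix_tree_def map2_suffix_tree_of_list[of _ _ _ "[]", unfolded tree_of_list.simps]
    by (auto simp: map2_suffix_tree_of_list suffix entry eq R intro!: arg_cong[where f = tree_of_list]
        simp del: drop_map)
  then show ?thesis unfolding R_def .
qed

lemma dot_tree_eq:
  assumes "length xs = length ys"
  shows "dot_tree A h i (tree_of_list xs) (tree_of_list ys)
     = foldl (\<lambda>a (x, y). on_finite A h (Node a (Node x y))) i (zip xs ys)"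
  using assms unfolding dot_tree_def
  by (induction xs ys arbitrary: i rule: list_induct2) auto

lemma step_tree_eq:
  "step_tree A h i (matrix_tree n E) = matrix_tree n (\<lambda>u v.
     foldl (\<lambda>a w. on_finite A h (Node a (Node (E u w) (E v w)))) i [0..<n])"
proof -
  define R where "R u = tree_of_list (map (E u) [0..<n])" for u
  have suffix: "left (tree_of_list (drop u (map R [0..<n]))) = R u" if "u < n" for u
    using that by (simp add: left_tree_of_list_drop del: drop_map)
  have fold: "foldl (\<lambda>a (x, y). f a x y) i (zip (map p ws) (map q ws)) = foldl (\<lambda>a w. f a (p w) (q w)) i ws"
    for f :: "tree \<Rightarrow> tree \<Rightarrow> tree \<Rightarrow> tree" and p q ws i
    by (induction ws arbitrary: i) auto
  have dot: "dot_tree A h i (R u) (R v) = foldl (\<lambda>a w. on_finite A h (Node a (Node (E u w) (E v w)))) i [0..<n]"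
    for u v
    unfolding R_def by (subst dot_tree_eq) (simp_all add: fold)
  show ?thesis
    unfolding step_tree_def matrix_tree_def R_def[symmetric]
      map2_suffix_tree_of_list[of _ _ _ "[]", unfolded tree_of_list.simps]
    by (auto simp: suffix dot intro!: arg_cong[where f = tree_of_list] simp del: drop_map)
qed

lemma spine_tree_of_list: "spine (tree_of_list xs) = length xs"
  by (induction xs) auto

lemma check_tree_eq:
  "check_tree b (matrix_tree n E) \<noteq> Leaf \<longleftrightarrow> (\<forall>u<n. E u 0 \<noteq> b)"
proof -
  have *: "fold2 (\<lambda>_ a x _. if tree_of_bool (left (left x) = b) = Leaf then a else Leaf) Leaf a (tree_of_list xs) Leaf
     \<noteq> Leaf \<longleftrightarrow> a \<noteq> Leaf \<and> (\<forall>x\<in>set xs. left x \<noteq> b)" for a xs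
    by (induction xs arbitrary: a) auto
  have "left (tree_of_list (map (E u) [0..<n])) = E u 0" if "u < n" for u
    using that by (simp add: upt_conv_Cons)
  then show ?thesis unfolding check_tree_def matrix_tree_def * by auto
qed


section \<open>Path consistency\<close>

text \<open>The old entry is no explicit operand of the intersection: when \<open>M v v\<close> is
  contained in the identity, the term for \<open>w = v\<close> lies below \<open>M u v\<close>. The
  converse in place of \<open>M w v\<close> has the effect that only the two rows of
  \<open>u\<close> and \<open>v\<close> are read, so that lists of rows suffice and nothing has to
  be transposed.\<close>

definition refine ::
    "nat \<Rightarrow> ('d \<times> 'd) set \<Rightarrow> (nat \<Rightarrow> nat \<Rightarrow> ('d \<times> 'd) set) \<Rightarrow> nat \<Rightarrow> nat \<Rightarrow> ('d \<times> 'd) set" where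
  "refine n X M u v = {p \<in> X. \<forall>w<n. p \<in> M u w O (M v w)\<inverse>}"

lemma foldl_inter: "foldl (\<lambda>a w. a \<inter> S w) X ws = {p \<in> X. \<forall>w\<in>set ws. p \<in> S w}"
  by (induction ws arbitrary: X) auto

text \<open>Any encoding that is injective on the subsets of \<open>X\<close> will do: the table for
  \<open>h\<close> hides the decoding, and the final test only compares with
  \<open>enc {}\<close>.\<close>

lemma solve_tree_eq:
  fixes enc :: "('d \<times> 'd) set \<Rightarrow> tree" and M :: "nat \<Rightarrow> nat \<Rightarrow> ('d \<times> 'd) set"
  assumes enc: "inj_on enc (Pow X)"
    and A': "A' = (\<lambda>(a, b, c). Node (enc a) (Node (enc b) (enc c))) ` (Pow X \<times> Pow X \<times> Pow X)"
    and h: "\<And>a b c. a \<subseteq> X \<Longrightarrow> b \<subseteq> X \<Longrightarrow> c \<subseteq> X \<Longrightarrow>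
      h (Node (enc a) (Node (enc b) (enc c))) = enc (a \<inter> (b O c\<inverse>))"
    and M: "\<And>u v. u < n \<Longrightarrow> v < n \<Longrightarrow> M u v \<subseteq> X"
    and T: "T = tree_of_list (map (\<lambda>v. Node (l v) (tree_of_list (map (e v) [0..<n]))) [0..<n])"
    and init: "\<And>u v. u < n \<Longrightarrow> v < n \<Longrightarrow>
      on_finite A g (Node (Node (l u) (l v)) (Node (e u v) (tree_of_bool (u = v)))) = enc (M u v)"
  shows "solve_tree A g A' h (enc X) k (enc {}) T \<noteq> Leaf
    \<longleftrightarrow> (\<forall>u<n. (refine n X ^^ (k * n * n)) M u 0 \<noteq> {})"
proof -
  have init': "init_tree A g T = matrix_tree n (\<lambda>u v. enc (M u v))"
    unfolding T init_tree_eq by (rule matrix_tree_cong) (rule init)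
  have step: "step_tree A' h (enc X) (matrix_tree n (\<lambda>u v. enc (N u v)))
      = matrix_tree n (\<lambda>u v. enc (refine n X N u v))"
    if N: "\<And>u v. u < n \<Longrightarrow> v < n \<Longrightarrow> N u v \<subseteq> X" for N
    unfolding step_tree_eq
  proof (rule matrix_tree_cong)
    fix u v assume uv: "u < n" "v < n"
    have "foldl (\<lambda>a w. on_finite A' h (Node a (Node (enc (N u w)) (enc (N v w))))) (enc Y) ws
        = enc (foldl (\<lambda>a w. a \<inter> (N u w O (N v w)\<inverse>)) Y ws)"
      if "Y \<subseteq> X" "set ws \<subseteq> {..<n}" for Y ws
      using that
    proof (induction ws arbitrary: Y)
      case (Cons w ws)
      then have sub: "N u w \<subseteq> X" "N v w \<subseteq> X" using N uv by auto
      then have "Node (enc Y) (Node (enc (N u w)) (enc (N v w))) \<in> A'"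
        using Cons.prems unfolding A' by (intro image_eqI[where x = "(Y, N u w, N v w)"]) auto
      then have "on_finite A' h (Node (enc Y) (Node (enc (N u w)) (enc (N v w))))
          = enc (Y \<inter> (N u w O (N v w)\<inverse>))"
        using h[OF _ sub, of Y] Cons.prems by (simp only: on_finite_def if_True)
      moreover have "Y \<inter> (N u w O (N v w)\<inverse>) \<subseteq> X" using Cons.prems by blast
      ultimately show ?case
        using Cons.IH[of "Y \<inter> (N u w O (N v w)\<inverse>)"] Cons.prems by (simp del: Int_subset_iff)
    qed simp
    from this[of X "[0..<n]"]
    show "foldl (\<lambda>a w. on_finite A' h (Node a (Node (enc (N u w)) (enc (N v w))))) (enc X) [0..<n]
        = enc (refine n X N u v)"
      by (simp add: foldl_inter refine_def atLeast0LessThan Ball_def)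
  qed
  have sub: "(refine n X ^^ j) M u v \<subseteq> X" if "u < n" "v < n" for j u v
    using M that by (cases j) (auto simp: refine_def)
  have iter: "right ((iterate_tree A' h (enc X) ^^ j) (Node c (matrix_tree n (\<lambda>u v. enc (M u v)))))
      = matrix_tree n (\<lambda>u v. enc ((refine n X ^^ j) M u v))" for j c
  proof (induction j)
    case (Suc j)
    show ?case
      using Suc.IH step[of "(refine n X ^^ j) M"] sub by (simp add: iterate_tree_def)
  qed simp
  have "spine (counter_tree k T) = k * n * n"
    by (simp add: spine_counter_tree T spine_tree_of_list)
  moreover have "enc ((refine n X ^^ (k * n * n)) M u 0) = enc {} \<longleftrightarrow> (refine n X ^^ (k * n * n)) M u 0 = {}"
    if "u < n" for u
    using inj_on_eq_iff[OF enc] sub[OF that, of 0] that by simp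
  ultimately show ?thesis
    unfolding solve_tree_def Let_def init' left.simps iter check_tree_eq by auto
qed

lemma polytime_solvableI:
  assumes "polytime_fun f" and "\<And>x. x \<in> I \<Longrightarrow> f (enc x) \<noteq> Leaf \<longleftrightarrow> Q x"
  shows "polytime_solvable enc I Q"
proof -
  obtain p B where "poly_bounded B" and p: "computes p f B"
    using assms(1) by (rule polytime_funE)
  then obtain k where k: "\<And>t. B t \<le> (size t + 2) ^ k" unfolding poly_bounded_def by blast
  \<comment> \<open>For \<open>m \<ge> 1\<close> one has \<open>m + 2 \<le> 3 * m\<close>; the case
    \<open>m = 0\<close> is absorbed by the additive constant.\<close>
  have le: "(m + 2) ^ k \<le> 3 ^ k * m ^ k + 3 ^ k" for m :: nat
  proof (cases m)
    case 0
    then show ?thesis by (simp add: power_mono trans_le_add2)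
  next
    case (Suc m')
    then have "(m + 2) ^ k \<le> (3 * m) ^ k" by (intro power_mono) auto
    then show ?thesis by (simp add: power_mult_distrib)
  qed
  show ?thesis
    unfolding polytime_solvable_def
  proof (rule exI[of _ p], rule exI[of _ "3 ^ k"], rule exI[of _ k], rule ballI)
    fix x assume "x \<in> I"
    obtain t s where *: "run p (input_state (enc x)) t s" "s 0 = f (enc x)" "t \<le> B (enc x)"
      using p[unfolded computes_def, rule_format, of "input_state (enc x)"]
      by (auto simp: input_state_def)
    have "t \<le> 3 ^ k * size (enc x) ^ k + 3 ^ k"
      using *(3) k[of "enc x"] le[of "size (enc x)"] by linarith
    with * show "\<exists>t s. run p (input_state (enc x)) t s \<and> t \<le> 3 ^ k * size (enc x) ^ k + 3 ^ k
        \<and> (s 0 \<noteq> Leaf \<longleftrightarrow> Q x)"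
      using assms(2)[OF \<open>x \<in> I\<close>] by (intro exI[of _ t] exI[of _ s]) auto
  qed
qed

text \<open>Every strict step costs an element, and a chain that pauses once never moves
  again.\<close>

lemma decreasing_sets_stabilise:
  fixes S :: "nat \<Rightarrow> 'a set"
  assumes "finite (S 0)" and "card (S 0) \<le> m" and "\<And>k. S (Suc k) \<subseteq> S k"
    and "\<And>k. S (Suc k) = S k \<Longrightarrow> S (Suc (Suc k)) = S (Suc k)"
  shows "S (Suc m) = S m"
  using assms
proof (induction m arbitrary: S)
  case 0
  then have "S 0 = {}" by (meson card_0_eq le_zero_eq)
  then show ?case using 0(3)[of 0] by blast
next
  case (Suc m)
  show ?case
  proof (cases "S (Suc 0) = S 0")
    case True
    note stable = Suc.prems(4)
    have "S (Suc k) = S k" for k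
    proof (induction k)
      case (Suc k)
      then show ?case by (rule stable)
    qed (rule True)
    then show ?thesis .
  next
    case False
    then have "S (Suc 0) \<subset> S 0" using Suc.prems(3)[of 0] by blast
    then have "card (S (Suc 0)) < card (S 0)" by (rule psubset_card_mono[OF Suc.prems(1)])
    then have "card (S (Suc 0)) \<le> m" using Suc.prems(2) by linarith
    moreover have "finite (S (Suc 0))" using Suc.prems(3)[of 0] Suc.prems(1) by (rule finite_subset)
    ultimately show ?thesis
    proof (intro Suc.IH[of "\<lambda>k. S (Suc k)"])
      show "S (Suc (Suc k)) \<subseteq> S (Suc k)" for k by (rule Suc.prems(3))
      show "S (Suc (Suc (Suc k))) = S (Suc (Suc k))" if "S (Suc (Suc k)) = S (Suc k)" for k
        using that by (rule Suc.prems(4))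
    qed
  qed
qed

lemma refine_subset:
  assumes "M v v \<subseteq> Id" and "v < n"
  shows "refine n X M u v \<subseteq> M u v"
proof
  fix p assume "p \<in> refine n X M u v"
  then have "p \<in> M u v O (M v v)\<inverse>" using assms(2) by (simp add: refine_def)
  then show "p \<in> M u v" using assms(1) by auto
qed

lemma refine_cong:
  assumes "\<And>u v. u < n \<Longrightarrow> v < n \<Longrightarrow> M u v = M' u v" and "u < n" and "v < n"
  shows "refine n X M u v = refine n X M' u v"
proof -
  have "p \<in> M u w O (M v w)\<inverse> \<longleftrightarrow> p \<in> M' u w O (M' v w)\<inverse>" if "w < n" for p w
    using assms(1)[of u w] assms(1)[of v w] assms(2,3) that by simp
  then show ?thesis unfolding refine_def by simp
qed

lemma refine_funpow_subset:
  assumes "\<And>v. v < n \<Longrightarrow> M v v \<subseteq> Id" and "v < n"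
  shows "(refine n X ^^ k) M u v \<subseteq> M u v"
  using assms(2)
proof (induction k arbitrary: u v)
  case (Suc k)
  have "(refine n X ^^ k) M v v \<subseteq> Id" using Suc.IH[OF Suc.prems] assms(1)[OF Suc.prems] by (rule order_trans)
  then have "refine n X ((refine n X ^^ k) M) u v \<subseteq> (refine n X ^^ k) M u v"
    using Suc.prems by (rule refine_subset)
  then show ?case using Suc.IH[OF Suc.prems, of u] unfolding funpow.simps comp_apply by (rule order_trans)
qed simp

lemma refine_fixpoint:
  assumes X: "finite X" and M: "\<And>u v. u < n \<Longrightarrow> v < n \<Longrightarrow> M u v \<subseteq> X"
    and Id: "\<And>v. v < n \<Longrightarrow> M v v \<subseteq> Id"
    and N: "N = (refine n X ^^ (card X * n * n)) M"
    and uvw: "u < n" "v < n" "w < n"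
  shows "N u v \<subseteq> N u w O (N v w)\<inverse>"
proof -
  \<comment> \<open>The part of the matrix with indices below \<open>n\<close>, collected in one set
    of at most \<open>card X * n * n\<close> triples. Its cardinality is the source of the number of
    rounds.\<close>
  define S where "S k = {(u, v, p). u < n \<and> v < n \<and> p \<in> (refine n X ^^ k) M u v}" for k
  have sub: "S k \<subseteq> {..<n} \<times> {..<n} \<times> X" for k
  proof -
    have "(refine n X ^^ k) M u v \<subseteq> X" if "u < n" "v < n" for u v
      using M that by (cases k) (auto simp: refine_def)
    then show ?thesis unfolding S_def by auto
  qed
  have fin: "finite ({..<n} \<times> {..<n} \<times> X)" using X by simp
  have eqI: "S j = S k \<longleftrightarrow> (\<forall>u<n. \<forall>v<n. (refine n X ^^ j) M u v = (refine n X ^^ k) M u v)" for j k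
  proof
    assume "S j = S k"
    then have "(u, v, p) \<in> S j \<longleftrightarrow> (u, v, p) \<in> S k" for u v p by simp
    then show "\<forall>u<n. \<forall>v<n. (refine n X ^^ j) M u v = (refine n X ^^ k) M u v"
      unfolding S_def by auto
  next
    assume "\<forall>u<n. \<forall>v<n. (refine n X ^^ j) M u v = (refine n X ^^ k) M u v"
    then show "S j = S k" unfolding S_def by (intro Collect_cong) (auto split: prod.splits)
  qed
  have "S (Suc (card X * n * n)) = S (card X * n * n)"
  proof (rule decreasing_sets_stabilise)
    show "finite (S 0)" using sub fin by (rule finite_subset)
    show "card (S 0) \<le> card X * n * n"
      using card_mono[OF fin sub[of 0]] by (simp add: card_cartesian_product ac_simps)
    have "(refine n X ^^ k) M v v \<subseteq> Id" if "v < n" for k v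
      using refine_funpow_subset[of n M v, where u = v and X = X and k = k] Id that by blast
    then have "(refine n X ^^ Suc k) M u v \<subseteq> (refine n X ^^ k) M u v" if "v < n" for k u v
      using refine_subset[of "(refine n X ^^ k) M" v n, where u = u and X = X] that by simp
    then show "S (Suc k) \<subseteq> S k" for k
      unfolding S_def by blast
    show "S (Suc (Suc k)) = S (Suc k)" if S: "S (Suc k) = S k" for k
    proof -
      have "refine n X ((refine n X ^^ Suc k) M) u v = refine n X ((refine n X ^^ k) M) u v"
        if "u < n" "v < n" for u v
        using S[unfolded eqI] that by (intro refine_cong) blast+
      then show ?thesis unfolding eqI by simp
    qed
  qed
  then have "(refine n X ^^ Suc (card X * n * n)) M u v = N u v"
    unfolding eqI N using uvw by blast
  then have fixed: "refine n X N u v = N u v" by (simp add: N)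
  show ?thesis
  proof
    fix p assume "p \<in> N u v"
    then have "p \<in> refine n X N u v" unfolding fixed .
    then show "p \<in> N u w O (N v w)\<inverse>" using uvw(3) by (simp add: refine_def)
  qed
qed


section \<open>Potentials\<close>

text \<open>
  Each component gets a root \<open>r\<close> and a value \<open>a\<close> at the root. Along a walk the difference of
  \<open>\<phi>\<close> is forced, so all pairs \<open>(a, y) \<in> R r v\<close> agree on \<open>\<phi> y\<close>, which is \<open>\<chi> v\<close>.
\<close>

lemma potential_exists:
  fixes R :: "'v \<Rightarrow> 'v \<Rightarrow> ('d \<times> 'd) set" and \<phi> :: "'d \<Rightarrow> bool"
  assumes "sym E" and EV: "E \<subseteq> V \<times> V"
    and comp: "\<And>u v w. u \<in> V \<Longrightarrow> (u, v) \<in> E\<^sup>* \<Longrightarrow> (u, w) \<in> E\<^sup>* \<Longrightarrow> R u v \<subseteq> R u w O (R v w)\<inverse>"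
    and diag: "\<And>v. v \<in> V \<Longrightarrow> R v v \<subseteq> Id" and nonempty: "\<And>v. v \<in> V \<Longrightarrow> R v v \<noteq> {}"
    and edge: "\<And>u v. (u, v) \<in> E \<Longrightarrow> \<exists>c. \<forall>(x, y)\<in>R u v. (\<phi> x \<noteq> \<phi> y) = c"
  obtains \<chi> where "\<And>v. v \<in> V \<Longrightarrow> \<exists>x. (x, x) \<in> R v v \<and> \<phi> x = \<chi> v"
    and "\<And>u v x y. u \<in> V \<Longrightarrow> (u, v) \<in> E\<^sup>* \<Longrightarrow> (x, y) \<in> R u v \<Longrightarrow> (\<phi> x \<noteq> \<phi> y) = (\<chi> u \<noteq> \<chi> v)"
proof -
  have symE: "(v, u) \<in> E\<^sup>*" if "(u, v) \<in> E\<^sup>*" for u v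
    using sym_rtrancl[OF assms(1)] that by (rule symD)
  have inV: "v \<in> V" if "(u, v) \<in> E\<^sup>*" "u \<in> V" for u v
    using that EV by (induction rule: rtrancl_induct) auto
  have const: "\<exists>c. \<forall>(x, y)\<in>R u v. (\<phi> x \<noteq> \<phi> y) = c" if "(u, v) \<in> E\<^sup>*" "u \<in> V" for u v
    using that(1)
  proof (induction rule: rtrancl_induct)
    case base
    show ?case using diag[OF that(2)] by (intro exI[of _ False]) auto
  next
    case (step v w)
    obtain c where c: "\<forall>(x, y)\<in>R u v. (\<phi> x \<noteq> \<phi> y) = c" using step.IH by (rule exE)
    obtain d where d: "\<forall>(x, y)\<in>R w v. (\<phi> x \<noteq> \<phi> y) = d"
      using edge[OF symD[OF assms(1) step.hyps(2)]] by (rule exE)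
    \<comment> \<open>Consistency passes every pair of \<open>R u w\<close> through a value at
      \<open>v\<close>, which splits its difference into the two known ones.\<close>
    have "R u w \<subseteq> R u v O (R w v)\<inverse>"
      using comp[OF that(2)] step.hyps by (meson rtrancl.rtrancl_into_rtrancl)
    then have "(\<phi> x \<noteq> \<phi> y) = (c \<noteq> d)" if xy: "(x, y) \<in> R u w" for x y
    proof -
      obtain z where "(x, z) \<in> R u v" "(y, z) \<in> R w v"
        using xy \<open>R u w \<subseteq> R u v O (R w v)\<inverse>\<close> by auto
      then show ?thesis using bspec[OF c, of "(x, z)"] bspec[OF d, of "(y, z)"] by auto
    qed
    then show ?case by (intro exI[of _ "c \<noteq> d"]) (simp add: split_beta)
  qed
  \<comment> \<open>The choice depends only on the set of vertices reachable from \<open>v\<close>,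
    which is the same for all vertices of a component; hence \<open>root_eq\<close>.\<close>
  define root where "root v = (SOME r. (v, r) \<in> E\<^sup>*)" for v
  have root: "(v, root v) \<in> E\<^sup>*" for v
    unfolding root_def by (rule someI[of _ v]) simp
  have root_eq: "root u = root v" if "(u, v) \<in> E\<^sup>*" for u v
  proof -
    have "(u, r) \<in> E\<^sup>* \<longleftrightarrow> (v, r) \<in> E\<^sup>*" for r
      using that symE rtrancl_trans by metis
    then show ?thesis unfolding root_def by simp
  qed
  define a where "a r = (SOME x. (x, x) \<in> R r r)" for r
  have a: "(a r, a r) \<in> R r r" if "r \<in> V" for r
    unfolding a_def using nonempty[OF that] diag[OF that] by (intro someI_ex[of "\<lambda>x. (x, x) \<in> R r r"]) auto
  define b where "b v = (SOME y. (a (root v), y) \<in> R (root v) v)" for v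
  have b: "(a (root v), b v) \<in> R (root v) v" if "v \<in> V" for v
  proof -
    have r: "root v \<in> V" using inV[OF root that] .
    have "R (root v) (root v) \<subseteq> R (root v) v O (R (root v) v)\<inverse>"
      using comp[OF r] symE[OF root] by blast
    then have "\<exists>y. (a (root v), y) \<in> R (root v) v" using a[OF r] by blast
    then show ?thesis unfolding b_def by (rule someI_ex)
  qed
  show thesis
  proof (rule that[of "\<lambda>v. \<phi> (b v)"])
    fix v assume v: "v \<in> V"
    have "R (root v) v \<subseteq> R (root v) v O (R v v)\<inverse>"
      using comp[OF inV[OF root v]] symE[OF root] by blast
    then obtain z where "(b v, z) \<in> R v v" using b[OF v] by blast
    then show "\<exists>x. (x, x) \<in> R v v \<and> \<phi> x = \<phi> (b v)" using diag[OF v] by blast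
  next
    fix u v x y assume u: "u \<in> V" and uv: "(u, v) \<in> E\<^sup>*" and xy: "(x, y) \<in> R u v"
    have v: "v \<in> V" and r: "root u \<in> V" and rv: "(root u, v) \<in> E\<^sup>*"
      using inV uv u root symE rtrancl_trans by metis+
    have "R (root u) u \<subseteq> R (root u) v O (R u v)\<inverse>"
      using comp[OF r] symE[OF root] rv by blast
    then obtain z where z: "(a (root u), z) \<in> R (root u) v" "(b u, z) \<in> R u v" using b[OF u] by blast
    \<comment> \<open>The value \<open>z\<close> supplied by consistency need not be
      \<open>b v\<close>, but both are partners of the same value at the root, so
      \<open>\<phi>\<close> agrees on them.\<close>
    have "(a (root u), b v) \<in> R (root u) v" using b[OF v] root_eq[OF uv] by simp
    then have "\<phi> z = \<phi> (b v)" using const[OF rv r] z(1) by blast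
    then show "(\<phi> x \<noteq> \<phi> y) = (\<phi> (b u) \<noteq> \<phi> (b v))" using const[OF uv u] z(2) xy by blast
  qed
qed

section \<open>Parities of walks and the potential of a uni-balanced graph\<close>

fun walk_parity :: "('a \<times> 'a) set \<Rightarrow> 'a list \<Rightarrow> bool" where
  "walk_parity N (x # y # zs) = (((x, y) \<in> N) \<noteq> walk_parity N (y # zs))"
| "walk_parity N _ = False"

abbreviation walk :: "('a \<times> 'a) set \<Rightarrow> 'a list \<Rightarrow> bool" where
  "walk E \<equiv> successively (\<lambda>x y. (x, y) \<in> E)"

lemma walk_parity_append:
  "walk_parity N (xs @ y # zs) = (walk_parity N (xs @ [y]) \<noteq> walk_parity N (y # zs))"
  by (induction N xs rule: walk_parity.induct) (auto simp: neq_Nil_conv elim: list.exhaust)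

lemma walk_append: "walk E (xs @ y # zs) \<longleftrightarrow> walk E (xs @ [y]) \<and> walk E (y # zs)"
  by (auto simp: successively_append_iff successively_Cons)

lemma walk_parity_card:
  "walk_parity N xs \<longleftrightarrow> odd (card {i. Suc i < length xs \<and> (xs ! i, xs ! Suc i) \<in> N})"
proof (induction N xs rule: walk_parity.induct)
  case (1 N x y zs)
  let ?S = "\<lambda>xs. {i. Suc i < length xs \<and> (xs ! i, xs ! Suc i) \<in> N}"
  have fin: "finite (?S (y # zs))" by (rule finite_subset[of _ "{..<length (y # zs)}"]) auto
  have "?S (x # y # zs) = (if (x, y) \<in> N then {0} else {}) \<union> Suc ` ?S (y # zs)"
  proof (rule set_eqI)
    fix i
    show "i \<in> ?S (x # y # zs) \<longleftrightarrow> i \<in> (if (x, y) \<in> N then {0} else {}) \<union> Suc ` ?S (y # zs)"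
      by (cases i) auto
  qed
  also have "card \<dots> = (if (x, y) \<in> N then 1 else 0) + card (?S (y # zs))"
    using fin by (auto simp: card_image)
  finally show ?case using 1 by auto
qed auto

text \<open>Splitting at a repeated vertex gives two shorter closed walks whose parities add up.
  Without repetition the walk is a cycle, or it runs along one edge and back.\<close>

lemma closed_walk_even:
  assumes cycles: "\<And>vs. cycle_in E vs \<Longrightarrow>
      even (card {i. i < length vs \<and> (vs ! i, vs ! (Suc i mod length vs)) \<in> N})"
    and "sym N" and "vs \<noteq> []" and "walk E (vs @ [hd vs])"
  shows "\<not> walk_parity N (vs @ [hd vs])"
  using assms(3,4)
proof (induction "length vs" arbitrary: vs rule: less_induct)
  case less
  show ?case
  proof (cases "distinct vs")
    case True
    show ?thesis
    proof (cases "length vs = 2")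
      \<comment> \<open>\<open>cycle_in\<close> excludes this length. The edge is traversed in both
        directions, so by symmetry of \<open>N\<close> it counts twice or not at all.\<close>
      case True
      then obtain a b where "vs = [a, b]" by (auto simp: length_Suc_conv numeral_2_eq_2)
      then show ?thesis using assms(2) by (auto dest: symD)
    next
      case False
      have nth: "(vs @ [hd vs]) ! i = vs ! i" "(vs @ [hd vs]) ! Suc i = vs ! (Suc i mod length vs)"
        if "i < length vs" for i
        using that less.prems(1) by (auto simp: nth_append hd_conv_nth) (metis Suc_lessI mod_self)
      have "cycle_in E vs"
        using True False less.prems nth unfolding cycle_in_def successively_conv_nth
        by (metis Suc_mono length_append_singleton)
      then have "even (card {i. i < length vs \<and> (vs ! i, vs ! (Suc i mod length vs)) \<in> N})"
        by (rule cycles)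
      moreover have "{i. i < length vs \<and> (vs ! i, vs ! (Suc i mod length vs)) \<in> N}
          = {i. Suc i < length (vs @ [hd vs]) \<and> ((vs @ [hd vs]) ! i, (vs @ [hd vs]) ! Suc i) \<in> N}"
        using nth by auto
      ultimately show ?thesis unfolding walk_parity_card by simp
    qed
  next
    case False
    then obtain as y bs cs where vs: "vs = as @ [y] @ bs @ [y] @ cs"
      using not_distinct_decomp by blast
    define h where "h = hd vs"
    have h: "hd (as @ y # cs) = h" by (cases as) (auto simp: h_def vs)
    have eq: "vs @ [h] = as @ y # bs @ y # cs @ [h]" by (simp add: vs)
    have w: "walk E (as @ [y])" "walk E ((y # bs) @ [y])" "walk E (y # cs @ [h])"
      using less.prems(2) unfolding h_def[symmetric] eq
      using walk_append[of E as y "bs @ y # cs @ [h]"] walk_append[of E "y # bs" y "cs @ [h]"] by auto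
    have "\<not> walk_parity N ((y # bs) @ [y])"
      using less.hyps[of "y # bs"] w(2) by (simp add: vs)
    moreover have "\<not> walk_parity N ((as @ y # cs) @ [h])"
      using less.hyps[of "as @ y # cs"] w(1,3) walk_append[of E as y "cs @ [h]"] h by (simp add: vs)
    ultimately have "\<not> walk_parity N (vs @ [h])"
      unfolding eq
      using walk_parity_append[of N as y "bs @ y # cs @ [h]"]
        walk_parity_append[of N "y # bs" y "cs @ [h]"] walk_parity_append[of N as y "cs @ [h]"]
      by simp
    then show ?thesis by (simp add: h_def)
  qed
qed

inductive parity_reach :: "('a \<times> 'a) set \<Rightarrow> ('a \<times> 'a) set \<Rightarrow> 'a \<Rightarrow> 'a \<Rightarrow> bool \<Rightarrow> bool" for E N u where
  refl: "parity_reach E N u u False"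
| step: "parity_reach E N u v c \<Longrightarrow> (v, w) \<in> E \<Longrightarrow> parity_reach E N u w (c \<noteq> ((v, w) \<in> N))"

lemma parity_reach_trans:
  assumes "parity_reach E N v w d" and "parity_reach E N u v c"
  shows "parity_reach E N u w (c \<noteq> d)"
  using assms
proof (induction rule: parity_reach.induct)
  case refl
  then show ?case by simp
next
  case (step w d x)
  have "parity_reach E N u x ((c \<noteq> d) \<noteq> ((w, x) \<in> N))"
    using step by (intro parity_reach.step) auto
  also have "((c \<noteq> d) \<noteq> ((w, x) \<in> N)) = (c \<noteq> (d \<noteq> ((w, x) \<in> N)))" by blast
  finally show ?case .
qed

lemma parity_reach_exists:
  assumes "(u, v) \<in> E\<^sup>*"
  shows "\<exists>c. parity_reach E N u v c"
  using assms by (induction rule: rtrancl_induct) (blast intro: parity_reach.intros)+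

lemma parity_reach_walk:
  assumes "parity_reach E N u v c"
  shows "\<exists>xs. walk E (xs @ [v]) \<and> hd (xs @ [v]) = u \<and> walk_parity N (xs @ [v]) = c"
  using assms
proof (induction rule: parity_reach.induct)
  case refl
  show ?case by (rule exI[of _ "[]"]) simp
next
  case (step v c w)
  then obtain xs where "walk E (xs @ [v])" "hd (xs @ [v]) = u" "walk_parity N (xs @ [v]) = c" by blast
  with step.hyps show ?case
    using walk_append[of E xs v "[w]"] walk_parity_append[of N xs v "[w]"]
    by (intro exI[of _ "xs @ [v]"]) (auto simp: hd_append)
qed

text \<open>Closed walks of unicoloured edges are even, so the parities of walks form a consistent
  family of relations on bits, to which \<open>potential_exists\<close> applies.
  \<open>\<tau>\<close> marks the vertices at which to switch so that every unicoloured edge becomes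
  blue.\<close>

lemma uni_balanced_potential:
  fixes H :: "'a sgraph"
  assumes "signed_graph H" and "uni_balanced H"
  obtains \<tau> :: "'a \<Rightarrow> bool" where "\<And>a b. (a, b) \<in> unicoloured H \<Longrightarrow> (a, b) \<in> neg H \<longleftrightarrow> \<tau> a \<noteq> \<tau> b"
proof -
  let ?E = "unicoloured H" and ?N = "neg H"
  define R :: "'a \<Rightarrow> 'a \<Rightarrow> (bool \<times> bool) set" where "R u v = {(x, y). parity_reach ?E ?N u v (x \<noteq> y)}" for u v
  have sym: "sym (pos H)" "sym ?N" "sym ?E" and V: "?E \<subseteq> verts H \<times> verts H"
    using assms(1) by (auto simp: signed_graph_def unicoloured_def sym_def)
  have closed: "\<not> c" if r: "parity_reach ?E ?N u u c" for u c
  proof -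
    obtain xs where xs: "walk ?E (xs @ [u])" "hd (xs @ [u]) = u" "walk_parity ?N (xs @ [u]) = c"
      using parity_reach_walk[OF r] by blast
    show ?thesis
    proof (cases "xs = []")
      case True
      then show ?thesis using xs by simp
    next
      case False
      then have "hd xs = u" using xs(2) by simp
      moreover have "\<not> walk_parity ?N (xs @ [hd xs])"
        by (rule closed_walk_even[OF _ sym(2) False])
          (use assms(2) xs(1) \<open>hd xs = u\<close> in \<open>auto simp: uni_balanced_def\<close>)
      ultimately show ?thesis using xs(3) by simp
    qed
  qed
  have one: "parity_reach ?E ?N u v ((u, v) \<in> ?N)" if "(u, v) \<in> ?E" for u v
    using parity_reach.step[OF parity_reach.refl that, of ?N] by simp
  have comp: "R u v \<subseteq> R u w O (R v w)\<inverse>" if "(u, v) \<in> ?E\<^sup>*" "(u, w) \<in> ?E\<^sup>*" for u v w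
  proof (rule subrelI)
    fix x y assume "(x, y) \<in> R u v"
    then have xy: "parity_reach ?E ?N u v (x \<noteq> y)" by (simp add: R_def)
    have vw: "(v, w) \<in> ?E\<^sup>*"
      using symD[OF sym_rtrancl[OF sym(3)] that(1)] that(2) by (rule rtrancl_trans)
    obtain c where c: "parity_reach ?E ?N v w c" using parity_reach_exists[OF vw] by (rule exE)
    have "((x \<noteq> y) \<noteq> c) = (x \<noteq> (y \<noteq> c))" "c = (y \<noteq> (y \<noteq> c))" by auto
    then have "(x, y \<noteq> c) \<in> R u w" "(y, y \<noteq> c) \<in> R v w"
      using parity_reach_trans[OF c xy] c unfolding R_def by simp_all
    then show "(x, y) \<in> R u w O (R v w)\<inverse>" by (intro relcompI converseI)
  qed
  have diag: "R v v \<subseteq> Id" for v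
    using closed by (auto simp: R_def)
  have nonempty: "R v v \<noteq> {}" for v
  proof -
    have "(False, False) \<in> R v v" using parity_reach.refl[of ?E ?N v] by (simp add: R_def)
    then show ?thesis by blast
  qed
  have edge: "(x \<noteq> y) = ((u, v) \<in> ?N)" if "(u, v) \<in> ?E" "(x, y) \<in> R u v" for u v x y
  \<comment> \<open>Going back along the edge closes any walk from \<open>u\<close> to
    \<open>v\<close>, so the parity of the walk has to be the sign of the edge.\<close>
  proof -
    have vu: "(v, u) \<in> ?E" using sym(3) that(1) by (rule symD)
    have "(v, u) \<in> ?N \<longleftrightarrow> (u, v) \<in> ?N" using sym(2) by (auto dest: symD)
    moreover have "parity_reach ?E ?N u v (x \<noteq> y)" using that(2) by (simp add: R_def)
    then have "\<not> ((x \<noteq> y) \<noteq> ((v, u) \<in> ?N))" by (rule closed[OF parity_reach.step[OF _ vu]])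
    ultimately show ?thesis by simp
  qed
  show thesis
  proof (rule potential_exists[OF sym(3) V, of R "\<lambda>x. x"])
    show "R u v \<subseteq> R u w O (R v w)\<inverse>" if "(u, v) \<in> ?E\<^sup>*" "(u, w) \<in> ?E\<^sup>*" for u v w
      using that by (rule comp)
    show "R v v \<subseteq> Id" "R v v \<noteq> {}" for v
      by (rule diag, rule nonempty)
    show "\<exists>c. \<forall>(x, y)\<in>R u v. (x \<noteq> y) = c" if "(u, v) \<in> ?E" for u v
      using edge[OF that] by (intro exI[of _ "(u, v) \<in> ?N"]) auto
  next
    fix \<chi> :: "'a \<Rightarrow> bool" assume \<chi>: "\<And>u v x y. u \<in> verts H \<Longrightarrow> (u, v) \<in> ?E\<^sup>* \<Longrightarrow> (x, y) \<in> R u v \<Longrightarrow>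
      (x \<noteq> y) = (\<chi> u \<noteq> \<chi> v)"
    show thesis
    proof (rule that[of \<chi>])
      fix a b assume ab: "(a, b) \<in> ?E"
      then have "(False, (a, b) \<in> ?N) \<in> R a b" using one by (simp add: R_def)
      moreover have "a \<in> verts H" using ab V by blast
      ultimately show "(a, b) \<in> ?N \<longleftrightarrow> \<chi> a \<noteq> \<chi> b"
        using \<chi>[of a b False "(a, b) \<in> ?N"] r_into_rtrancl[OF ab] by simp
    qed
  qed
qed

section \<open>Switching\<close>

text \<open>\<open>p\<close> and \<open>q\<close> tell whether an edge of the instance is at least
  positive and at least negative. The bits are the switchings at its two ends; unequal bits exchange
  the signs.\<close>

definition compatible :: "'h sgraph \<Rightarrow> bool \<Rightarrow> bool \<Rightarrow> 'h \<times> bool \<Rightarrow> 'h \<times> bool \<Rightarrow> bool" where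
  "compatible H p q = (\<lambda>(a, s) (b, t).
     (p \<longrightarrow> (if s = t then (a, b) \<in> pos H else (a, b) \<in> neg H)) \<and>
     (q \<longrightarrow> (if s = t then (a, b) \<in> neg H else (a, b) \<in> pos H)))"

definition switch_by :: "('a \<Rightarrow> bool) \<Rightarrow> 'a sgraph \<Rightarrow> 'a sgraph" where
  "switch_by s G = G\<lparr>
     pos := {(x, y). if s x = s y then (x, y) \<in> pos G else (x, y) \<in> neg G},
     neg := {(x, y). if s x = s y then (x, y) \<in> neg G else (x, y) \<in> pos G}\<rparr>"

lemma switch_switch_by: "switch v (switch_by s G) = switch_by (s(v := \<not> s v)) G"
  unfolding switch_def switch_by_def by (cases G) (auto simp: fun_eq_iff)

lemma switchings_switch_by:
  assumes "switchings G G'"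
  shows "\<exists>s. G' = switch_by s G"
  using assms
proof (induction rule: switchings.induct)
  case refl
  have "G = switch_by (\<lambda>_. False) G" unfolding switch_by_def by (cases G) auto
  then show ?case by blast
next
  case (step G' v)
  then show ?case using switch_switch_by by metis
qed

lemma switch_by_switchings:
  assumes "finite S" and "S \<subseteq> verts G"
  shows "switchings G (switch_by (\<lambda>x. x \<in> S) G)"
  using assms
proof (induction S rule: finite_induct)
  case empty
  have "G = switch_by (\<lambda>x. x \<in> {}) G" unfolding switch_by_def by (cases G) auto
  then show ?case using switchings.refl by metis
next
  case (insert v S)
  have "(\<lambda>x. x \<in> insert v S) = (\<lambda>x. x \<in> S)(v := \<not> v \<in> S)"
    using insert.hyps by (auto simp: fun_eq_iff)
  then show ?case
    using switchings.step[of G "switch_by (\<lambda>x. x \<in> S) G" v] insert by (simp add: switch_switch_by)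
qed

lemma s_hom_switch_by:
  "((\<forall>(u, v)\<in>pos (switch_by s G). (f u, f v) \<in> pos H) \<and> (\<forall>(u, v)\<in>neg (switch_by s G). (f u, f v) \<in> neg H))
    \<longleftrightarrow> (\<forall>u v. compatible H ((u, v) \<in> pos G) ((u, v) \<in> neg G) (f u, s u) (f v, s v))"
  (is "?A \<longleftrightarrow> ?B")
proof -
  have *: "((u, v) \<in> pos (switch_by s G) \<longrightarrow> (f u, f v) \<in> pos H)
      \<and> ((u, v) \<in> neg (switch_by s G) \<longrightarrow> (f u, f v) \<in> neg H)
    \<longleftrightarrow> compatible H ((u, v) \<in> pos G) ((u, v) \<in> neg G) (f u, s u) (f v, s v)" for u v
    by (cases "s u = s v") (simp_all add: switch_by_def compatible_def conj_commute)
  have "?A \<longleftrightarrow> (\<forall>u v. ((u, v) \<in> pos (switch_by s G) \<longrightarrow> (f u, f v) \<in> pos H)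
      \<and> ((u, v) \<in> neg (switch_by s G) \<longrightarrow> (f u, f v) \<in> neg H))"
    unfolding Ball_def split_paired_All prod.case by blast
  then show ?thesis unfolding * .
qed

lemma s_hom_iff:
  assumes "signed_graph G"
  shows "s_hom G H f \<longleftrightarrow> (\<forall>v\<in>verts G. f v \<in> verts H) \<and>
    (\<exists>s. \<forall>u v. compatible H ((u, v) \<in> pos G) ((u, v) \<in> neg G) (f u, s u) (f v, s v))"
proof -
  have "(\<exists>G'. switchings G G' \<and> (\<forall>(u, v)\<in>pos G'. (f u, f v) \<in> pos H) \<and> (\<forall>(u, v)\<in>neg G'. (f u, f v) \<in> neg H))
      \<longleftrightarrow> (\<exists>s. \<forall>u v. compatible H ((u, v) \<in> pos G) ((u, v) \<in> neg G) (f u, s u) (f v, s v))"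
    (is "?A \<longleftrightarrow> ?B")
  proof
    assume ?A
    then obtain G' where G': "switchings G G'"
      "(\<forall>(u, v)\<in>pos G'. (f u, f v) \<in> pos H) \<and> (\<forall>(u, v)\<in>neg G'. (f u, f v) \<in> neg H)" by (rule exE) blast
    obtain s where "G' = switch_by s G" using switchings_switch_by[OF G'(1)] by (elim exE)
    from s_hom_switch_by[THEN iffD1, OF G'(2)[unfolded this]] show ?B by (rule exI[where x = s])
  next
    assume ?B
    then obtain s where s: "\<And>u v. compatible H ((u, v) \<in> pos G) ((u, v) \<in> neg G) (f u, s u) (f v, s v)"
      by blast
    \<comment> \<open>Switching is possible at vertices only. Resetting \<open>s\<close> elsewhere
      is harmless, because no edge ends there.\<close>
    let ?S = "{v \<in> verts G. s v}"
    have "compatible H ((u, v) \<in> pos G) ((u, v) \<in> neg G) (f u, u \<in> ?S) (f v, v \<in> ?S)" for u v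
    proof (cases "(u, v) \<in> edges G")
      case True
      then have "u \<in> verts G" "v \<in> verts G" using assms by (auto simp: signed_graph_def edges_def)
      then show ?thesis using s by simp
    next
      case False
      then show ?thesis by (simp add: edges_def compatible_def)
    qed
    then have "\<forall>u v. compatible H ((u, v) \<in> pos G) ((u, v) \<in> neg G) (f u, u \<in> ?S) (f v, v \<in> ?S)"
      by blast
    note hom = s_hom_switch_by[of "\<lambda>x. x \<in> ?S" G f H, THEN iffD2, OF this]
    have "switchings G (switch_by (\<lambda>x. x \<in> ?S) G)"
      using assms by (intro switch_by_switchings) (auto simp: signed_graph_def)
    with hom show ?A by (intro exI[of _ "switch_by (\<lambda>x. x \<in> ?S) G"]) (rule conjI)
  qed
  then show ?thesis unfolding s_hom_def by blast
qed

lemma bicoloured_or_unicoloured: "(a, b) \<in> edges H \<longleftrightarrow> (a, b) \<in> bicoloured H \<or> (a, b) \<in> unicoloured H"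
  by (auto simp: edges_def bicoloured_def unicoloured_def)

lemma not_bicoloured_unicoloured: "(a, b) \<in> bicoloured H \<Longrightarrow> (a, b) \<notin> unicoloured H"
  by (auto simp: bicoloured_def unicoloured_def)

lemma unicoloured_neg_iff: "(a, b) \<in> unicoloured H \<Longrightarrow> (a, b) \<in> neg H \<longleftrightarrow> (a, b) \<notin> pos H"
  by (auto simp: unicoloured_def)


section \<open>Targets with a special bipartite min ordering\<close>

text \<open>The two orders become one relation, assumed total only between vertices of equal colour,
  so that each condition covers both sides of the bipartition at once. Uni-balance is present in the
  form of \<open>\<tau>\<close>.\<close>

locale special_target =
  fixes H :: "'h sgraph" and B :: "'h set" and lt :: "'h \<Rightarrow> 'h \<Rightarrow> bool" and \<tau> :: "'h \<Rightarrow> bool"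
  assumes signed_graph: "signed_graph H"
    and edge_colour: "(a, b) \<in> edges H \<Longrightarrow> (a \<in> B) \<noteq> (b \<in> B)"
    and lt_irrefl: "\<not> lt a a"
    and lt_trans: "lt a b \<Longrightarrow> lt b c \<Longrightarrow> lt a c"
    and lt_total: "a \<in> verts H \<Longrightarrow> b \<in> verts H \<Longrightarrow> (a \<in> B) = (b \<in> B) \<Longrightarrow> a = b \<or> lt a b \<or> lt b a"
    and min_ordering: "(a, b') \<in> edges H \<Longrightarrow> (a', b) \<in> edges H \<Longrightarrow> lt a a' \<Longrightarrow> lt b b' \<Longrightarrow> (a, b) \<in> edges H"
    and special: "(a, b) \<in> bicoloured H \<Longrightarrow> (a, c) \<in> unicoloured H \<Longrightarrow> lt b c"
    and connected: "a \<in> verts H \<Longrightarrow> b \<in> verts H \<Longrightarrow> (a, b) \<in> (unicoloured H)\<^sup>*"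
    and potential: "(a, b) \<in> unicoloured H \<Longrightarrow> (a, b) \<in> neg H \<longleftrightarrow> \<tau> a \<noteq> \<tau> b"
begin

definition le :: "'h \<Rightarrow> 'h \<Rightarrow> bool" where
  "le a b \<longleftrightarrow> a = b \<or> lt a b"

lemma edges_sym: "(a, b) \<in> edges H \<Longrightarrow> (b, a) \<in> edges H"
  using signed_graph by (auto simp: signed_graph_def edges_def dest: symD)

lemma bicoloured_sym: "(a, b) \<in> bicoloured H \<Longrightarrow> (b, a) \<in> bicoloured H"
  using signed_graph by (auto simp: signed_graph_def bicoloured_def dest: symD)

lemma unicoloured_sym: "(a, b) \<in> unicoloured H \<Longrightarrow> (b, a) \<in> unicoloured H"
  using signed_graph by (auto simp: signed_graph_def unicoloured_def dest: symD)

lemma edges_verts: "(a, b) \<in> edges H \<Longrightarrow> a \<in> verts H \<and> b \<in> verts H"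
  using signed_graph by (auto simp: signed_graph_def edges_def)

text \<open>
  The vertices that are at least \<open>b\<close> or joined to \<open>a\<close> by a bicoloured edge, together with those that
  are at least \<open>a\<close> or joined to \<open>b\<close> by a bicoloured edge, are thus closed under unicoloured edges.
  By connectedness they are all vertices.
\<close>

lemma unicoloured_step:
  assumes ab: "(a, b) \<in> bicoloured H" and cz: "(c, z) \<in> unicoloured H"
    and colour: "(c \<in> B) = (b \<in> B)" and c: "le b c \<or> (a, c) \<in> bicoloured H"
  shows "le a z \<or> (z, b) \<in> bicoloured H"
proof (cases "(a, c) \<in> bicoloured H")
  case True
  then show ?thesis using special[OF bicoloured_sym cz] by (simp add: le_def)
next
  case False
  then have "lt b c" using c ab by (auto simp: le_def)
  have edges: "(a, b) \<in> edges H" "(c, z) \<in> edges H"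
    using ab cz by (auto simp: bicoloured_or_unicoloured)
  then have "(z \<in> B) = (a \<in> B)" using edge_colour colour by blast
  then consider "le a z" | "lt z a"
    using lt_total[of a z] edges edges_verts by (auto simp: le_def)
  then show ?thesis
  proof cases
    \<comment> \<open>The edges \<open>a b\<close> and \<open>z c\<close> cross, so the min ordering
      gives the edge \<open>z b\<close>. If it were unicoloured, \<open>special\<close> at
      \<open>b\<close> would put \<open>a\<close> before \<open>z\<close>.\<close>
    case 2
    then have "(z, b) \<in> edges H"
      using min_ordering[of z c a b] edges edges_sym \<open>lt b c\<close> by blast
    then show ?thesis
      using special[OF bicoloured_sym[OF ab], of z] unicoloured_sym
      by (auto simp: bicoloured_or_unicoloured le_def)
  qed simp
qed

text \<open>\<open>unicoloured_step\<close> carries the alternative between order and bicoloured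
  edge along a walk of unicoloured edges from \<open>b\<close> to \<open>c\<close>. At
  \<open>c\<close> the order alternative fails, because \<open>c\<close> is below
  \<open>b\<close>.\<close>

lemma bicoloured_lower:
  assumes ab: "(a, b) \<in> bicoloured H" and "lt c b" and c: "c \<in> verts H" "(c \<in> B) = (b \<in> B)"
  shows "(a, c) \<in> bicoloured H"
proof -
  have ba: "(b, a) \<in> bicoloured H" using bicoloured_sym[OF ab] .
  have "b \<in> verts H" using ab edges_verts[of a b] by (simp add: bicoloured_or_unicoloured)
  have colours: "(a \<in> B) \<noteq> (b \<in> B)" using ab edge_colour by (simp add: bicoloured_or_unicoloured)
  \<comment> \<open>Every unicoloured edge changes the colour, so the claim for one colour is
    derived from that for the other, and both go through a single induction.\<close>
  have "((z \<in> B) = (b \<in> B) \<longrightarrow> le b z \<or> (a, z) \<in> bicoloured H)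
      \<and> ((z \<in> B) = (a \<in> B) \<longrightarrow> le a z \<or> (b, z) \<in> bicoloured H)" if "(b, z) \<in> (unicoloured H)\<^sup>*" for z
    using that
  proof (induction rule: rtrancl_induct)
    case base
    show ?case using colours by (auto simp: le_def)
  next
    case (step y z)
    have yz: "(y \<in> B) \<noteq> (z \<in> B)" using step.hyps(2) edge_colour by (simp add: bicoloured_or_unicoloured)
    have "le a z \<or> (b, z) \<in> bicoloured H" if "(z \<in> B) = (a \<in> B)"
      using unicoloured_step[OF ab step.hyps(2)] that step.IH yz colours bicoloured_sym by blast
    moreover have "le b z \<or> (a, z) \<in> bicoloured H" if "(z \<in> B) = (b \<in> B)"
      using unicoloured_step[OF ba step.hyps(2)] that step.IH yz colours bicoloured_sym by blast
    ultimately show ?case by blast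
  qed
  then have "le b c \<or> (a, c) \<in> bicoloured H" using connected[OF \<open>b \<in> verts H\<close> c(1)] c(2) by blast
  then show ?thesis using \<open>lt c b\<close> lt_trans lt_irrefl by (auto simp: le_def)
qed

lemma bicoloured_down:
  assumes ab: "(a, b) \<in> bicoloured H" and le: "le a' a" "le b' b"
    and verts: "a' \<in> verts H" "b' \<in> verts H" and colour: "(a' \<in> B) = (a \<in> B)" "(b' \<in> B) = (b \<in> B)"
  shows "(a', b') \<in> bicoloured H"
proof -
  have "(a, b') \<in> bicoloured H"
    using bicoloured_lower[OF ab] le(2) verts(2) colour(2) ab by (auto simp: le_def)
  then show ?thesis
    using bicoloured_lower[OF bicoloured_sym, of a b' a'] bicoloured_sym le(1) verts(1) colour(1)
    by (auto simp: le_def)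
qed

lemma ex_least:
  assumes "finite S" and "S \<noteq> {}" and "S \<subseteq> verts H" and "\<And>a b. a \<in> S \<Longrightarrow> b \<in> S \<Longrightarrow> (a \<in> B) = (b \<in> B)"
  shows "\<exists>m\<in>S. \<forall>a\<in>S. le m a"
proof -
  have asym: "\<not> lt b a" if "lt a b" for a b using lt_trans[OF that] lt_irrefl by blast
  have "asymp_on S lt" by (rule asymp_onI) (rule asym)
  moreover have "transp_on S lt" by (rule transp_onI) (rule lt_trans)
  ultimately obtain m where m: "m \<in> S" "\<forall>x\<in>S. x \<noteq> m \<longrightarrow> \<not> lt x m"
    using Finite_Set.bex_min_element[OF assms(1) _ _ assms(2)] by blast
  have "le m a" if a: "a \<in> S" for a
  proof -
    have "m = a \<or> lt m a \<or> lt a m"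
      using assms(3) m(1) a assms(4)[OF m(1) a] by (intro lt_total) auto
    then show ?thesis using m(2) a unfolding le_def by auto
  qed
  with m(1) show ?thesis by blast
qed

text \<open>
  In every component one of its two colourings by black and white is chosen (\<open>\<chi>\<close>), and every vertex
  is sent to the least remaining value of its colour. By \<open>bicoloured_down\<close> this sends as many edges as possible to
  bicoloured edges. On the edges sent to unicoloured ones all remaining pairs agree on the
  signs, so that a switching can be read off from the pairs.
\<close>

lemma path_consistent_hom:
  fixes G :: "nat sgraph" and R :: "nat \<Rightarrow> nat \<Rightarrow> (('h \<times> bool) \<times> ('h \<times> bool)) set"
  assumes G: "signed_graph G"
    and comp: "\<And>u v w. u \<in> verts G \<Longrightarrow> v \<in> verts G \<Longrightarrow> w \<in> verts G \<Longrightarrow> R u v \<subseteq> R u w O (R v w)\<inverse>"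
    and diag: "\<And>v. v \<in> verts G \<Longrightarrow> R v v \<subseteq> Id" and nonempty: "\<And>v. v \<in> verts G \<Longrightarrow> R v v \<noteq> {}"
    and lists: "\<And>v a s. v \<in> verts G \<Longrightarrow> ((a, s), (a, s)) \<in> R v v \<Longrightarrow> a \<in> L v"
    and L: "\<And>v. v \<in> verts G \<Longrightarrow> L v \<subseteq> verts H"
    and compat: "\<And>u v x y. u \<in> verts G \<Longrightarrow> v \<in> verts G \<Longrightarrow> (x, y) \<in> R u v \<Longrightarrow>
      compatible H ((u, v) \<in> pos G) ((u, v) \<in> neg G) x y"
  shows "\<exists>f. s_hom G H f \<and> (\<forall>v\<in>verts G. f v \<in> L v)"
proof -
  let ?V = "verts G" and ?E = "edges G"
  have symE: "sym ?E" and EV: "?E \<subseteq> ?V \<times> ?V"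
    using G by (auto simp: signed_graph_def edges_def intro: sym_Un)
  have inV: "v \<in> ?V" if "(u, v) \<in> ?E\<^sup>*" "u \<in> ?V" for u v
    using that EV by (induction rule: rtrancl_induct) auto
  have edge: "(fst x, fst y) \<in> edges H" if "(u, v) \<in> ?E" "(x, y) \<in> R u v" for u v x y
    using compat[OF _ _ that(2)] that(1) EV
    by (auto simp: compatible_def edges_def split_beta split: if_splits)
  obtain \<chi> where \<chi>1: "\<And>v. v \<in> ?V \<Longrightarrow> \<exists>x. (x, x) \<in> R v v \<and> (fst x \<in> B) = \<chi> v"
    and \<chi>2: "\<And>u v x y. u \<in> ?V \<Longrightarrow> (u, v) \<in> ?E\<^sup>* \<Longrightarrow> (x, y) \<in> R u v \<Longrightarrow>
      ((fst x \<in> B) \<noteq> (fst y \<in> B)) = (\<chi> u \<noteq> \<chi> v)"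
  proof (rule potential_exists[OF symE EV, of R "\<lambda>x. fst x \<in> B"])
    show "R u v \<subseteq> R u w O (R v w)\<inverse>" if "u \<in> ?V" "(u, v) \<in> ?E\<^sup>*" "(u, w) \<in> ?E\<^sup>*" for u v w
      using that inV by (intro comp) auto
    show "\<exists>c. \<forall>(x, y)\<in>R u v. ((fst x \<in> B) \<noteq> (fst y \<in> B)) = c" if "(u, v) \<in> ?E" for u v
      using edge_colour[OF edge[OF that]] by (intro exI[of _ True]) auto
    show "R v v \<subseteq> Id" "R v v \<noteq> {}" if "v \<in> ?V" for v
      by (intro diag nonempty that)+
  qed (rule that)
  \<comment> \<open>Restricting to the chosen colours keeps consistency: by \<open>\<chi>2\<close>,
    an intermediate value has the right colour as soon as the first value has it.\<close>
  define N where "N u v = {(x, y) \<in> R u v. (fst x \<in> B) = \<chi> u \<and> (fst y \<in> B) = \<chi> v}" for u v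
  have NR: "N u v \<subseteq> R u v" for u v by (auto simp: N_def)
  have Ncomp: "N u v \<subseteq> N u w O (N v w)\<inverse>"
    if u: "u \<in> ?V" and uv: "(u, v) \<in> ?E\<^sup>*" and uw: "(u, w) \<in> ?E\<^sup>*" for u v w
  proof (rule subrelI)
    fix x y assume xy: "(x, y) \<in> N u v"
    then obtain z where z: "(x, z) \<in> R u w" "(y, z) \<in> R v w"
      using comp[OF u inV[OF uv u] inV[OF uw u]] NR by blast
    have "(fst z \<in> B) = \<chi> w" using \<chi>2[OF u uw z(1)] xy by (auto simp: N_def)
    then have "(x, z) \<in> N u w" "(y, z) \<in> N v w" using z xy by (auto simp: N_def)
    then show "(x, y) \<in> N u w O (N v w)\<inverse>" by (intro relcompI converseI)
  qed
  have Ndiag: "N v v \<subseteq> Id" if "v \<in> ?V" for v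
    using NR diag[OF that] by (rule order_trans)
  have Nnonempty: "N v v \<noteq> {}" if v: "v \<in> ?V" for v
  proof -
    obtain x where "(x, x) \<in> R v v" "(fst x \<in> B) = \<chi> v" using \<chi>1[OF v] by (elim exE conjE)
    then have "(x, x) \<in> N v v" by (simp add: N_def)
    then show ?thesis by blast
  qed
  \<comment> \<open>Only the vertices are kept; the bits are recovered at the end from
    \<open>\<psi>\<close>.\<close>
  define C where "C v = {a. \<exists>s. ((a, s), (a, s)) \<in> N v v}" for v
  have CL: "C v \<subseteq> L v" if "v \<in> ?V" for v using lists[OF that] NR unfolding C_def by blast
  have Cverts: "C v \<subseteq> verts H" if "v \<in> ?V" for v using CL[OF that] L[OF that] by (rule order_trans)
  have Ccolour: "(a \<in> B) = \<chi> v" if "a \<in> C v" for a v using that by (auto simp: C_def N_def)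
  have "\<exists>m\<in>C v. \<forall>a\<in>C v. le m a" if v: "v \<in> ?V" for v
  proof (rule ex_least)
    show "finite (C v)"
      using Cverts[OF v] signed_graph by (auto simp: signed_graph_def intro: finite_subset)
    obtain x y where "(x, y) \<in> N v v" using Nnonempty[OF v] by auto
    moreover from this have "x = y" using Ndiag[OF v] by blast
    ultimately have "fst x \<in> C v" by (cases x) (auto simp: C_def)
    then show "C v \<noteq> {}" by blast
  qed (use Cverts[OF v] Ccolour in auto)
  then obtain f where f: "\<And>v. v \<in> ?V \<Longrightarrow> f v \<in> C v" "\<And>v a. v \<in> ?V \<Longrightarrow> a \<in> C v \<Longrightarrow> le (f v) a"
    by metis
  have fverts: "f v \<in> verts H" if "v \<in> ?V" for v using f(1) Cverts that by blast
  have members: "fst x \<in> C u \<and> fst y \<in> C v" if uv: "(u, v) \<in> ?E" and xy: "(x, y) \<in> N u v" for u v x y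
  proof -
    have u: "u \<in> ?V" and v: "v \<in> ?V" using uv EV by auto
    obtain z where "(x, z) \<in> N u u" using Ncomp[OF u r_into_rtrancl[OF uv] rtrancl_refl] xy by blast
    moreover from this have "z = x" using Ndiag[OF u] by blast
    moreover obtain z' where "(y, z') \<in> N v v"
      using Ncomp[OF u r_into_rtrancl[OF uv] r_into_rtrancl[OF uv]] xy by blast
    moreover from this have "z' = y" using Ndiag[OF v] by blast
    ultimately show ?thesis by (cases x, cases y) (auto simp: C_def)
  qed
  have support: "\<exists>y. ((f u, s), y) \<in> N u v" if uv: "(u, v) \<in> ?E" and s: "((f u, s), (f u, s)) \<in> N u u" for u v s
    using Ncomp[of u u v, OF _ rtrancl_refl r_into_rtrancl[OF uv]] EV uv s by blast
  have Nex: "\<exists>s y. ((f u, s), y) \<in> N u v" if "(u, v) \<in> ?E" for u v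
  proof -
    have "u \<in> ?V" using that EV by blast
    then obtain s where "((f u, s), (f u, s)) \<in> N u u" using f(1) by (auto simp: C_def)
    then show ?thesis using support[OF that] by blast
  qed
  have down: "(f u, f v) \<in> bicoloured H"
    if uv: "(u, v) \<in> ?E" and xy: "(x, y) \<in> N u v" and bi: "(fst x, fst y) \<in> bicoloured H" for u v x y
  proof -
    have u: "u \<in> ?V" and v: "v \<in> ?V" using uv EV by auto
    show ?thesis
      using bicoloured_down[OF bi f(2)[OF u] f(2)[OF v] fverts[OF u] fverts[OF v]]
        members[OF uv xy] Ccolour f(1)[OF u] f(1)[OF v] by metis
  qed
  \<comment> \<open>Support in both directions gives edges from \<open>f u\<close> to some vertex
    not below \<open>f v\<close> and from some vertex not below \<open>f u\<close> to
    \<open>f v\<close>. The min ordering uncrosses them.\<close>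
  have fedge: "(f u, f v) \<in> edges H" if uv: "(u, v) \<in> ?E" for u v
  proof -
    have vu: "(v, u) \<in> ?E" using symE uv by (rule symD)
    have u: "u \<in> ?V" and v: "v \<in> ?V" using uv EV by auto
    obtain s y where y: "((f u, s), y) \<in> N u v" using Nex[OF uv] by blast
    obtain t x where x: "((f v, t), x) \<in> N v u" using Nex[OF vu] by blast
    have e: "(f u, fst y) \<in> edges H" "(fst x, f v) \<in> edges H"
      using edge[OF uv subsetD[OF NR y]] edge[OF vu subsetD[OF NR x]] by (auto intro: edges_sym)
    have "le (f v) (fst y)" "le (f u) (fst x)"
      using members[OF uv y] members[OF vu x] f(2) u v by auto
    then show ?thesis using e min_ordering[of "f u" "fst y" "fst x" "f v"] by (auto simp: le_def)
  qed
  \<comment> \<open>Edges sent to bicoloured ones put no condition on the signs, so only the others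
    constrain the switching.\<close>
  define U where "U = {(u, v) \<in> ?E. (f u, f v) \<in> unicoloured H}"
  have UE: "U \<subseteq> ?E" and symU: "sym U"
    using symE unicoloured_sym by (auto simp: U_def sym_def)
  have UV: "U \<subseteq> ?V \<times> ?V" using UE EV by (rule order_trans)
  \<comment> \<open>An edge with both signs has only bicoloured pairs as support, and
    \<open>down\<close> would make its image bicoloured.\<close>
  have not_both: "\<not> ((u, v) \<in> pos G \<and> (u, v) \<in> neg G)" if "(u, v) \<in> U" for u v
  proof
    assume both: "(u, v) \<in> pos G \<and> (u, v) \<in> neg G"
    have uv: "(u, v) \<in> ?E" "u \<in> ?V" "v \<in> ?V" using that UE UV by auto
    obtain s y where y: "((f u, s), y) \<in> N u v" using Nex[OF uv(1)] by blast
    then have "compatible H True True (f u, s) y"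
      using compat[OF uv(2,3), of "(f u, s)" y] NR both by auto
    then have "(f u, fst y) \<in> bicoloured H"
      by (auto simp: compatible_def bicoloured_def split_beta split: if_splits)
    then have "(f u, f v) \<in> bicoloured H" using down[OF uv(1) y] by simp
    then show False using that by (auto simp: U_def dest: not_bicoloured_unicoloured)
  qed
  \<comment> \<open>By \<open>down\<close>, every remaining pair on such an edge is unicoloured.
    Correcting bits by \<open>\<tau>\<close> amounts to switching \<open>H\<close> until its
    unicoloured edges are blue, so the corrected bits differ exactly if the edge of the instance is
    red, whichever pair is taken.\<close>
  have sign: "((snd x \<noteq> \<tau> (fst x)) \<noteq> (snd y \<noteq> \<tau> (fst y))) = ((u, v) \<in> neg G)"
    if uv: "(u, v) \<in> U" and xy: "(x, y) \<in> N u v" for u v x y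
  proof -
    have E: "(u, v) \<in> ?E" "u \<in> ?V" "v \<in> ?V" using that UE UV by auto
    have "(fst x, fst y) \<in> edges H" using edge[OF E(1)] xy NR by blast
    moreover have "(fst x, fst y) \<notin> bicoloured H"
      using down[OF E(1) xy] uv by (auto simp: U_def dest: not_bicoloured_unicoloured)
    ultimately have uni: "(fst x, fst y) \<in> unicoloured H" by (simp add: bicoloured_or_unicoloured)
    have "compatible H ((u, v) \<in> pos G) ((u, v) \<in> neg G) x y" using compat[OF E(2,3)] xy NR by blast
    then show ?thesis
      using not_both[OF uv] E(1) potential[OF uni] unicoloured_neg_iff[OF uni]
      by (cases "snd x = snd y"; cases "(u, v) \<in> neg G") (auto simp: compatible_def edges_def split_beta)
  qed
  obtain \<psi> :: "nat \<Rightarrow> bool" where \<psi>: "\<And>u v x y. u \<in> ?V \<Longrightarrow> (u, v) \<in> U\<^sup>* \<Longrightarrow> (x, y) \<in> N u v \<Longrightarrow>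
      ((snd x \<noteq> \<tau> (fst x)) \<noteq> (snd y \<noteq> \<tau> (fst y))) = (\<psi> u \<noteq> \<psi> v)"
  proof (rule potential_exists[OF symU UV, of N "\<lambda>x. snd x \<noteq> \<tau> (fst x)"])
    show "N u v \<subseteq> N u w O (N v w)\<inverse>" if "u \<in> ?V" "(u, v) \<in> U\<^sup>*" "(u, w) \<in> U\<^sup>*" for u v w
      using Ncomp[OF that(1)] that(2,3) rtrancl_mono[OF UE] by (meson subsetD)
    show "\<exists>c. \<forall>(x, y)\<in>N u v. ((snd x \<noteq> \<tau> (fst x)) \<noteq> (snd y \<noteq> \<tau> (fst y))) = c" if "(u, v) \<in> U" for u v
      using sign[OF that] by (intro exI[of _ "(u, v) \<in> neg G"]) (simp add: split_beta)
    show "N v v \<subseteq> Id" "N v v \<noteq> {}" if "v \<in> ?V" for v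
      by (intro Ndiag Nnonempty that)+
  next
    fix \<psi> :: "nat \<Rightarrow> bool" assume "\<And>u v x y. u \<in> ?V \<Longrightarrow> (u, v) \<in> U\<^sup>* \<Longrightarrow> (x, y) \<in> N u v \<Longrightarrow>
      ((snd x \<noteq> \<tau> (fst x)) \<noteq> (snd y \<noteq> \<tau> (fst y))) = (\<psi> u \<noteq> \<psi> v)"
    then show thesis by (rule that[of \<psi>])
  qed
  have \<psi>U: "(\<psi> u \<noteq> \<psi> v) = ((u, v) \<in> neg G)" if uv: "(u, v) \<in> U" for u v
  proof -
    have u: "u \<in> ?V" and E: "(u, v) \<in> ?E" using uv UV UE by auto
    obtain s y where y: "((f u, s), y) \<in> N u v" using Nex[OF E] by blast
    show ?thesis using \<psi>[OF u r_into_rtrancl[OF uv] y] sign[OF uv y] by (rule trans[OF sym])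
  qed
  \<comment> \<open>Undoes the correction: \<open>\<psi> v\<close> plays the part of the corrected
    bit at \<open>f v\<close>.\<close>
  define s where "s v = (\<psi> v \<noteq> \<tau> (f v))" for v
  have "compatible H ((u, v) \<in> pos G) ((u, v) \<in> neg G) (f u, s u) (f v, s v)" for u v
  proof (cases "(u, v) \<in> ?E")
    case False
    then show ?thesis by (simp add: compatible_def edges_def)
  next
    case True
    show ?thesis
    proof (cases "(f u, f v) \<in> bicoloured H")
      case True
      then show ?thesis by (simp add: compatible_def bicoloured_def)
    next
      case False
      then have uni: "(f u, f v) \<in> unicoloured H"
        using fedge[OF True] by (simp add: bicoloured_or_unicoloured)
      then have uv: "(u, v) \<in> U" using True by (simp add: U_def)
      have "(s u = s v) = (((u, v) \<in> neg G) = ((f u, f v) \<in> neg H))"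
        unfolding potential[OF uni] \<psi>U[OF uv, symmetric] s_def by blast
      then show ?thesis
        using not_both[OF uv] unicoloured_neg_iff[OF uni] True
        by (auto simp: compatible_def edges_def)
    qed
  qed
  moreover have "\<forall>v\<in>?V. f v \<in> L v" using f(1) CL by blast
  ultimately show ?thesis
    using fverts by (intro exI[of _ f]) (auto simp: s_hom_iff[OF G])
qed

end

lemma special_target_exists:
  fixes H :: "'h sgraph"
  assumes H: "signed_graph H" and "uni_balanced H" and "uni_spanning_connected H"
    and ord: "special_bipartite_min_ordering H B W ltb ltw"
  obtains lt \<tau> where "special_target H B lt \<tau>"
proof -
  obtain \<tau> :: "'h \<Rightarrow> bool" where \<tau>: "\<And>a b. (a, b) \<in> unicoloured H \<Longrightarrow> (a, b) \<in> neg H \<longleftrightarrow> \<tau> a \<noteq> \<tau> b"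
    using uni_balanced_potential[OF assms(1,2)] by blast
  define lt where "lt a b \<longleftrightarrow> a \<in> B \<and> b \<in> B \<and> (a, b) \<in> ltb \<or> a \<in> W \<and> b \<in> W \<and> (a, b) \<in> ltw" for a b
  have min: "bipartite_min_ordering H B W ltb ltw"
    using ord by (simp add: special_bipartite_min_ordering_def)
  have V: "B \<union> W = verts H" and BW: "B \<inter> W = {}" and E: "edges H \<subseteq> B \<times> W \<union> W \<times> B"
    using min by (auto simp: bipartite_min_ordering_def bipartition_def)
  have strict: "trans ltb" "irrefl ltb" "total_on B ltb" "trans ltw" "irrefl ltw" "total_on W ltw"
    using min by (auto simp: bipartite_min_ordering_def strict_linear_order_on_def)
  have minD: "(x, y) \<in> edges H"
    if "x \<in> W" "x' \<in> W" "y \<in> B" "y' \<in> B" "(x, x') \<in> ltw" "(y, y') \<in> ltb" "(x, y') \<in> edges H" "(x', y) \<in> edges H"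
    for x x' y y'
    using min that unfolding bipartite_min_ordering_def by blast
  have special1: "(y, y') \<in> ltw"
    if "x \<in> B" "y \<in> W" "y' \<in> W" "(x, y) \<in> bicoloured H" "(x, y') \<in> unicoloured H" for x y y'
    using ord that unfolding special_bipartite_min_ordering_def by blast
  have special2: "(x, x') \<in> ltb"
    if "x \<in> B" "x' \<in> B" "y \<in> W" "(x, y) \<in> bicoloured H" "(x', y) \<in> unicoloured H" for x x' y
    using ord that unfolding special_bipartite_min_ordering_def by blast
  have sym: "(b, a) \<in> edges H" if "(a, b) \<in> edges H" for a b
    using H that by (auto simp: signed_graph_def edges_def dest: symD)
  have sym_bi: "(b, a) \<in> bicoloured H" if "(a, b) \<in> bicoloured H" for a b
    using H that by (auto simp: signed_graph_def bicoloured_def dest: symD)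
  have sym_uni: "(b, a) \<in> unicoloured H" if "(a, b) \<in> unicoloured H" for a b
    using H that by (auto simp: signed_graph_def unicoloured_def dest: symD)
  have "special_target H B lt \<tau>"
  proof
    show "signed_graph H" by (rule H)
    show "(a \<in> B) \<noteq> (b \<in> B)" if "(a, b) \<in> edges H" for a b
      using that E BW by blast
    show "\<not> lt a a" for a
      using strict(2,5) unfolding lt_def irrefl_def by blast
    show "lt a c" if "lt a b" "lt b c" for a b c
      using that strict(1,4) BW unfolding lt_def trans_def by blast
    show "a = b \<or> lt a b \<or> lt b a" if "a \<in> verts H" "b \<in> verts H" "(a \<in> B) = (b \<in> B)" for a b
      using that strict(3,6) V unfolding lt_def total_on_def by blast
    show "(a, b) \<in> edges H" if "(a, b') \<in> edges H" "(a', b) \<in> edges H" "lt a a'" "lt b b'" for a b a' b'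
    proof (cases "a \<in> B")
      case True
      then have "a' \<in> B" "(a, a') \<in> ltb" using that(3) BW unfolding lt_def by blast+
      moreover have "b \<in> W" "b' \<in> W" using True that(1,2) E BW \<open>a' \<in> B\<close> by blast+
      moreover from this have "(b, b') \<in> ltw" using that(4) BW unfolding lt_def by blast
      ultimately have "(b, a) \<in> edges H" using minD[of b b' a a'] sym that(1,2) True by blast
      then show ?thesis by (rule sym)
    next
      case False
      then have "a \<in> W" "a' \<in> W" "(a, a') \<in> ltw" using that(3) unfolding lt_def by blast+
      moreover from this have "b \<in> B" "b' \<in> B" using that(1,2) E BW by blast+
      moreover from this have "(b, b') \<in> ltb" using that(4) BW unfolding lt_def by blast
      ultimately show ?thesis using minD[of a a' b b'] that(1,2) by blast
    qed
    show "lt b c" if "(a, b) \<in> bicoloured H" "(a, c) \<in> unicoloured H" for a b c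
    proof -
      have e: "(a, b) \<in> edges H" "(a, c) \<in> edges H"
        using that by (simp_all add: bicoloured_or_unicoloured)
      show ?thesis
      proof (cases "a \<in> B")
        case True
        then have "b \<in> W" "c \<in> W" using e E BW by blast+
        then show ?thesis using special1[OF True _ _ that] by (simp add: lt_def)
      next
        case False
        then have "a \<in> W" "b \<in> B" "c \<in> B" using e E by blast+
        then show ?thesis using special2[OF _ _ _ sym_bi[OF that(1)] sym_uni[OF that(2)]] by (simp add: lt_def)
      qed
    qed
    show "(a, b) \<in> (unicoloured H)\<^sup>*" if "a \<in> verts H" "b \<in> verts H" for a b
    proof -
      obtain F where "F \<subseteq> unicoloured H" "connected_graph (verts H) F"
        using assms(3) unfolding uni_spanning_connected_def by blast
      then show ?thesis
        using that rtrancl_mono[of F "unicoloured H"] unfolding connected_graph_def by blast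
    qed
    show "(a, b) \<in> neg H \<longleftrightarrow> \<tau> a \<noteq> \<tau> b" if "(a, b) \<in> unicoloured H" for a b
      using that by (rule \<tau>)
  qed
  then show thesis by (rule that)
qed


section \<open>The algorithm\<close>

text \<open>\<open>d\<close> marks the diagonal. The equality imposed there places the diagonal
  relation inside the identity, which makes \<open>refine\<close> decreasing; it then carries the
  list of the vertex together with the condition from a loop.\<close>

definition constraint ::
    "'h sgraph \<Rightarrow> 'h set \<Rightarrow> 'h set \<Rightarrow> bool \<Rightarrow> bool \<Rightarrow> bool \<Rightarrow> (('h \<times> bool) \<times> ('h \<times> bool)) set" where
  "constraint H S S' p q d =
     {(x, y). fst x \<in> S \<and> fst y \<in> S' \<and> compatible H p q x y \<and> (d \<longrightarrow> x = y)}"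

definition instance_matrix ::
    "'h sgraph \<Rightarrow> 'h lhom_instance \<Rightarrow> nat \<Rightarrow> nat \<Rightarrow> (('h \<times> bool) \<times> ('h \<times> bool)) set" where
  "instance_matrix H = (\<lambda>(G, L) u v. constraint H (L u) (L v) ((u, v) \<in> pos G) ((u, v) \<in> neg G) (u = v))"

definition pairs :: "'h sgraph \<Rightarrow> (('h \<times> bool) \<times> ('h \<times> bool)) set" where
  "pairs H = (verts H \<times> UNIV) \<times> (verts H \<times> UNIV)"

lemma finite_pairs: "signed_graph H \<Longrightarrow> finite (pairs H)"
  by (simp add: pairs_def signed_graph_def)

lemma instance_matrix_subset:
  assumes "(G, L) \<in> lhom_instances H" and "u < card (verts G)" and "v < card (verts G)"
  shows "instance_matrix H (G, L) u v \<subseteq> pairs H"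
proof -
  have "L u \<subseteq> verts H" "L v \<subseteq> verts H"
    using assms unfolding lhom_instances_def by blast+
  then show ?thesis unfolding instance_matrix_def constraint_def pairs_def by auto
qed

lemma has_list_s_hom_iff_path_consistent:
  fixes H :: "'h sgraph"
  assumes "special_target H B lt \<tau>" and GL: "(G, L) \<in> lhom_instances H" and n: "n = card (verts G)"
  shows "has_list_s_hom H (G, L) \<longleftrightarrow>
    (\<forall>u<n. (refine n (pairs H) ^^ (card (pairs H) * n * n)) (instance_matrix H (G, L)) u 0 \<noteq> {})"
proof -
  interpret special_target H B lt \<tau> by (rule assms(1))
  let ?M = "instance_matrix H (G, L)"
  have G: "signed_graph G" and V: "verts G = {..<n}" and L: "\<And>v. v < n \<Longrightarrow> L v \<subseteq> verts H"
    using GL n unfolding lhom_instances_def by auto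
  have sub: "?M u v \<subseteq> pairs H" if "u < n" "v < n" for u v
    using instance_matrix_subset[OF GL] that n by simp
  have diagM: "?M v v \<subseteq> Id" for v by (auto simp: instance_matrix_def constraint_def)
  show ?thesis
  proof
    assume "has_list_s_hom H (G, L)"
    then obtain f where f: "s_hom G H f" "\<forall>v\<in>verts G. f v \<in> L v"
      unfolding has_list_s_hom_def by blast
    obtain s where s: "\<forall>u v. compatible H ((u, v) \<in> pos G) ((u, v) \<in> neg G) (f u, s u) (f v, s v)"
      using f(1) unfolding s_hom_iff[OF G] by (elim conjE exE)
    \<comment> \<open>A solution survives every round, its own value at \<open>w\<close> being the
      intermediate value.\<close>
    have "((f u, s u), (f v, s v)) \<in> (refine n (pairs H) ^^ k) ?M u v" if "u < n" "v < n" for k u v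
      using that
    proof (induction k arbitrary: u v)
      case 0
      then show ?case using f(2) s V by (simp add: instance_matrix_def constraint_def)
    next
      case (Suc k)
      have "((f u, s u), (f v, s v)) \<in> pairs H"
        using f(2) V L Suc.prems unfolding pairs_def by auto
      moreover have "((f u, s u), (f v, s v)) \<in> (refine n (pairs H) ^^ k) ?M u w O ((refine n (pairs H) ^^ k) ?M v w)\<inverse>"
        if "w < n" for w
        using Suc.IH[OF Suc.prems(1) that] Suc.IH[OF Suc.prems(2) that] by (intro relcompI converseI)
      moreover have "p \<in> refine n (pairs H) M u v \<longleftrightarrow> p \<in> pairs H \<and> (\<forall>w<n. p \<in> M u w O (M v w)\<inverse>)"
        for p M
        by (simp add: refine_def)
      ultimately show ?case by simp
    qed
    then show "\<forall>u<n. (refine n (pairs H) ^^ (card (pairs H) * n * n)) ?M u 0 \<noteq> {}"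
      by (metis empty_iff gr_zeroI not_less_zero)
  next
    define N where "N = (refine n (pairs H) ^^ (card (pairs H) * n * n)) ?M"
    assume "\<forall>u<n. (refine n (pairs H) ^^ (card (pairs H) * n * n)) ?M u 0 \<noteq> {}"
    then have N0: "N u 0 \<noteq> {}" if "u < n" for u using that by (simp add: N_def)
    have comp: "N u v \<subseteq> N u w O (N v w)\<inverse>" if "u < n" "v < n" "w < n" for u v w
      by (rule refine_fixpoint[OF finite_pairs[OF signed_graph] sub diagM N_def that])
    have NM: "N u v \<subseteq> ?M u v" if "v < n" for u v
      unfolding N_def using diagM that by (rule refine_funpow_subset)
    have "\<exists>f. s_hom G H f \<and> (\<forall>v\<in>verts G. f v \<in> L v)"
    proof (rule path_consistent_hom[OF G, of N L])
      fix u v w assume uvw: "u \<in> verts G" "v \<in> verts G" "w \<in> verts G"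
      then show "N u v \<subseteq> N u w O (N v w)\<inverse>" using V by (intro comp) auto
    next
      fix v assume v: "v \<in> verts G"
      show "N v v \<subseteq> Id" using NM[of v v] diagM[of v] v V by auto
      \<comment> \<open>Only column \<open>0\<close> is known to be nonempty. Its pairs at
        \<open>(v, 0)\<close> pass through \<open>v\<close>, so the diagonal entry is nonempty too;
        \<open>0\<close> is a vertex because \<open>v < n\<close>.\<close>
      have "N v 0 \<subseteq> N v v O (N 0 v)\<inverse>" using v V by (intro comp) auto
      then show "N v v \<noteq> {}" using N0[of v] v V by auto
      show "L v \<subseteq> verts H" using L v V by simp
      show "a \<in> L v" if "((a, s), (a, s)) \<in> N v v" for a s
        using subsetD[OF NM that] v V by (simp add: instance_matrix_def constraint_def)
    next
      fix u v x y assume "u \<in> verts G" "v \<in> verts G" and xy: "(x, y) \<in> N u v"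
      then show "compatible H ((u, v) \<in> pos G) ((u, v) \<in> neg G) x y"
        using subsetD[OF NM xy] V by (simp add: instance_matrix_def constraint_def)
    qed
    then show "has_list_s_hom H (G, L)" by (simp add: has_list_s_hom_def)
  qed
qed

section \<open>Encodings by trees and the final program\<close>

lemma finite_tree_encoding:
  assumes "finite X"
  obtains enc :: "'a \<Rightarrow> tree" where "inj_on enc X"
proof -
  obtain f :: "'a \<Rightarrow> nat" where "inj_on f X"
    using finite_imp_inj_to_nat_seg[OF assms] by blast
  moreover have "inj (\<lambda>n. (Node Leaf ^^ n) Leaf)"
    by (rule injI) (metis add.left_neutral size_Node_Leaf_funpow tree.size(3))
  ultimately have "inj_on ((\<lambda>n. (Node Leaf ^^ n) Leaf) \<circ> f) X"
    by (meson comp_inj_on inj_on_subset subset_UNIV)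
  then show thesis by (rule that)
qed

definition list_tree :: "'h list \<Rightarrow> 'h set \<Rightarrow> tree" where
  "list_tree hs S = tree_of_list (map (\<lambda>a. tree_of_bool (a \<in> S)) hs)"

lemma tree_of_bool_inj: "tree_of_bool b = tree_of_bool c \<longleftrightarrow> b = c"
  by (cases b; cases c) auto

lemma inj_on_list_tree: "inj_on (list_tree hs) (Pow (set hs))"
  by (rule inj_onI) (auto simp: list_tree_def tree_of_list_inj tree_of_bool_inj)

lemma encode_lhom_eq:
  assumes "n = card (verts G)"
  shows "encode_lhom hs (G, L) = tree_of_list (map (\<lambda>v. Node (list_tree hs (L v))
    (tree_of_list (map (\<lambda>w. Node (tree_of_bool ((v, w) \<in> pos G)) (tree_of_bool ((v, w) \<in> neg G))) [0..<n])))
      [0..<n])"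
  by (simp add: encode_lhom_def list_tree_def assms Let_def)

theorem theorem9:
  fixes H :: "'h sgraph"
  assumes "signed_graph H"
    and "irreflexive H"
    and "uni_balanced H"
    and "uni_spanning_connected H"
    and "\<exists>B W ltb ltw. special_bipartite_min_ordering H B W ltb ltw"
  shows "list_s_hom_polytime H"
  unfolding list_s_hom_polytime_def
proof (intro allI impI)
  fix hs :: "'h list" assume hs: "distinct hs \<and> set hs = verts H"
  obtain B W ltb ltw where "special_bipartite_min_ordering H B W ltb ltw"
    using assms(5) by blast
  then obtain lt \<tau> where target: "special_target H B lt \<tau>"
    using special_target_exists[OF assms(1,3,4)] by blast
  let ?X = "pairs H" and ?V = "verts H"
  have X: "finite ?X" and V: "finite ?V"
    using assms(1) by (auto simp: finite_pairs signed_graph_def)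
  obtain enc :: "(('h \<times> bool) \<times> ('h \<times> bool)) set \<Rightarrow> tree" where enc: "inj_on enc (Pow ?X)"
    using finite_tree_encoding[of "Pow ?X"] X by blast
  define dec where "dec = inv_into (Pow ?X) enc"
  have dec: "dec (enc a) = a" if "a \<subseteq> ?X" for a
    unfolding dec_def using enc that by (intro inv_into_f_f) auto
  define lists where "lists = inv_into (Pow ?V) (list_tree hs)"
  have lists: "lists (list_tree hs S) = S" if "S \<subseteq> ?V" for S
    unfolding lists_def using inj_on_list_tree[of hs] hs that by (intro inv_into_f_f) auto
  \<comment> \<open>All keys that an initial entry can have: two lists, two sign bits and the
    diagonal bit. They are finitely many because the target is fixed.\<close>
  define A where "A = (\<lambda>(S, S', p, q, d). Node (Node (list_tree hs S) (list_tree hs S'))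
      (Node (Node (tree_of_bool p) (tree_of_bool q)) (tree_of_bool d)))
    ` (Pow ?V \<times> Pow ?V \<times> (UNIV :: (bool \<times> bool \<times> bool) set))"
  define g where "g t = enc (constraint H (lists (left (left t))) (lists (right (left t)))
      (left (left (right t)) \<noteq> Leaf) (right (left (right t)) \<noteq> Leaf) (right (right t) \<noteq> Leaf))" for t
  define A' where "A' = (\<lambda>(a, b, c). Node (enc a) (Node (enc b) (enc c))) ` (Pow ?X \<times> Pow ?X \<times> Pow ?X)"
  define h where "h t = enc (dec (left t) \<inter> (dec (left (right t)) O (dec (right (right t)))\<inverse>))" for t
  have init: "on_finite A g (Node (Node (list_tree hs S) (list_tree hs S'))
      (Node (Node (tree_of_bool p) (tree_of_bool q)) (tree_of_bool d))) = enc (constraint H S S' p q d)"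
    if "S \<subseteq> ?V" "S' \<subseteq> ?V" for S S' p q d
  proof -
    have "Node (Node (list_tree hs S) (list_tree hs S'))
      (Node (Node (tree_of_bool p) (tree_of_bool q)) (tree_of_bool d)) \<in> A"
      unfolding A_def using that by (intro image_eqI[where x = "(S, S', p, q, d)"]) auto
    then show ?thesis unfolding on_finite_def by (simp add: g_def lists that)
  qed
  have "finite A" unfolding A_def using V by (intro finite_imageI finite_cartesian_product) auto
  moreover have "finite A'" unfolding A'_def using X by (intro finite_imageI finite_cartesian_product) auto
  \<comment> \<open>Tables and constants depend on \<open>H\<close> and \<open>hs\<close> only, so
    one program serves all instances.\<close>
  ultimately have "polytime_fun (solve_tree A g A' h (enc ?X) (card ?X) (enc {}))"
    by (rule polytime_fun_solve_tree)
  then show "polytime_solvable (encode_lhom hs) (lhom_instances H) (has_list_s_hom H)"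
  proof (rule polytime_solvableI)
    fix I assume "I \<in> lhom_instances H"
    then obtain G L where I: "I = (G, L)" and GL: "(G, L) \<in> lhom_instances H" by (cases I) auto
    define n where "n = card (verts G)"
    have L: "L v \<subseteq> ?V" if "v < n" for v
      using GL that unfolding lhom_instances_def n_def by blast
    have "solve_tree A g A' h (enc ?X) (card ?X) (enc {}) (encode_lhom hs (G, L)) \<noteq> Leaf
      \<longleftrightarrow> (\<forall>u<n. (refine n ?X ^^ (card ?X * n * n)) (instance_matrix H (G, L)) u 0 \<noteq> {})"
    proof (rule solve_tree_eq[OF enc A'_def _ _ encode_lhom_eq[OF n_def]])
      show "h (Node (enc a) (Node (enc b) (enc c))) = enc (a \<inter> (b O c\<inverse>))"
        if "a \<subseteq> ?X" "b \<subseteq> ?X" "c \<subseteq> ?X" for a b c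
        using that by (simp add: h_def dec)
      show "instance_matrix H (G, L) u v \<subseteq> ?X" if "u < n" "v < n" for u v
        using instance_matrix_subset[OF GL] that by (simp add: n_def)
      show "on_finite A g (Node (Node (list_tree hs (L u)) (list_tree hs (L v)))
          (Node (Node (tree_of_bool ((u, v) \<in> pos G)) (tree_of_bool ((u, v) \<in> neg G))) (tree_of_bool (u = v))))
        = enc (instance_matrix H (G, L) u v)" if "u < n" "v < n" for u v
        using init[OF L L] that by (simp add: instance_matrix_def)
    qed
    then show "solve_tree A g A' h (enc ?X) (card ?X) (enc {}) (encode_lhom hs I) \<noteq> Leaf \<longleftrightarrow> has_list_s_hom H I"
      unfolding I has_list_s_hom_iff_path_consistent[OF target GL n_def] .
  qed
qed

end
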